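(* For any $A,B\in\mathcal B^{+*}(H)$ and $v\in[0,1]$ we have $$L_v(A,B)=L\big(A\sharp_v B,A\big)\nabla_v L\big(A\sharp_v B,B\big)$$ and $$I_v(A,B)=I\big(A\nabla_v B,A\big)\sharp_v I\big(A\nabla_v B,B\big).$$
   Context: $H$ is a complex Hilbert space, $\mathcal B(H)$ the $C^*$-algebra of bounded linear operators on $H$, and $\mathcal B^{+*}(H)$ the open cone of all (self-adjoint) positive invertible operators in $\mathcal B(H)$. For $A,B\in\mathcal B^{+*}(H)$ and $v\in[0,1]$: $$A\nabla_v B=(1-v)A+vB,\qquad A\sharp_v B=A^{1/2}\big(A^{-1/2}BA^{-1/2}\big)^vA^{1/2}.$$ Scalar weighted logarithmic and identric means: for $a\neq b$ in $(0,\infty)$ and $v\in(0,1)$, with $a\nabla_v b=(1-v)a+vb$, $$L_v(a,b)=\frac{1}{\log a-\log b}\left(\frac{1-v}{v}\big(a-a^{1-v}b^v\big)+\frac{v}{1-v}\big(a^{1-v}b^v-b\big)\right),$$ $$I_v(a,b)=\frac1e\,\big(a\nabla_v b\big)^{\frac{(1-2v)(a\nabla_v b)}{v(1-v)(b-a)}}\left(\frac{b^{\frac{vb}{1-v}}}{a^{\frac{(1-v)a}{v}}}\right)^{\frac1{b-a}},$$ with the limit values $L_0(a,b)=I_0(a,b)=a$, $L_1(a,b)=I_1(a,b)=b$, and $L_v(a,a)=I_v(a,a)=a$. The weighted logarithmic and identric means of operators $A,B\in\mathcal B^{+*}(H)$ are defined by continuous functional calculus: $$L_v(A,B)=A^{1/2}F_{L_v}\big(A^{-1/2}BA^{-1/2}\big)A^{1/2},\quad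 F_{L_v}(x)=L_v(1,x),$$ $$I_v(A,B)=A^{1/2}F_{I_v}\big(A^{-1/2}BA^{-1/2}\big)A^{1/2},\quad F_{I_v}(x)=I_v(1,x),$$ for $x>0$. For $v=1/2$ they are denoted $L(A,B):=L_{1/2}(A,B)$ and $I(A,B):=I_{1/2}(A,B)$. *)

theory Defs
  imports "HOL-Analysis.Analysis" "HOL-Computational_Algebra.Polynomial"
begin

text \<open>
  Complex Hilbert spaces. The inner product is linear in its first argument; the last
  axiom contains positive definiteness, since the norm is already definite. Completeness
  is inherited from \<^class>\<open>banach\<close>.
\<close>

class complex_hilbert_space = banach +
  fixes scaleC :: "complex \<Rightarrow> 'a \<Rightarrow> 'a"  (infixr \<open>*\<^sub>C\<close> 75)
    and cinner :: "'a \<Rightarrow> 'a \<Rightarrow> complex"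
  assumes scaleC_add_right: "c *\<^sub>C (x + y) = c *\<^sub>C x + c *\<^sub>C y"
    and scaleC_add_left: "(c + d) *\<^sub>C x = c *\<^sub>C x + d *\<^sub>C x"
    and scaleC_scaleC: "c *\<^sub>C d *\<^sub>C x = (c * d) *\<^sub>C x"
    and scaleC_of_real: "complex_of_real r *\<^sub>C x = r *\<^sub>R x"
    and cinner_add_left: "cinner (x + y) z = cinner x z + cinner y z"
    and cinner_scaleC_left: "cinner (c *\<^sub>C x) y = c * cinner x y"
    and cinner_commute: "cinner x y = cnj (cinner y x)"
    and cinner_self: "cinner x x = complex_of_real ((norm x)\<^sup>2)"

text \<open>
  The type \<open>'a \<Rightarrow>\<^sub>L 'a\<close> consists of the bounded \<^emph>\<open>real\<close>-linear operators; the algebra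
  of bounded operators on the complex space is its complex-linear part, with the same
  operator norm.
\<close>

definition bounded_ops :: "('a::complex_hilbert_space \<Rightarrow>\<^sub>L 'a) set" where
  "bounded_ops = {T. \<forall>c x. blinfun_apply T (c *\<^sub>C x) = c *\<^sub>C blinfun_apply T x}"

definition op_invertible :: "('a::complex_hilbert_space \<Rightarrow>\<^sub>L 'a) \<Rightarrow> bool" where
  "op_invertible T \<longleftrightarrow>
     (\<exists>S\<in>bounded_ops. S o\<^sub>L T = id_blinfun \<and> T o\<^sub>L S = id_blinfun)"

definition self_adjoint :: "('a::complex_hilbert_space \<Rightarrow>\<^sub>L 'a) \<Rightarrow> bool" where
  "self_adjoint T \<longleftrightarrow>
     (\<forall>x y. cinner (blinfun_apply T x) y = cinner x (blinfun_apply T y))"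

definition pos_inv_ops :: "('a::complex_hilbert_space \<Rightarrow>\<^sub>L 'a) set" where
  "pos_inv_ops = {T \<in> bounded_ops.
     self_adjoint T \<and> (\<forall>x. 0 \<le> Re (cinner (blinfun_apply T x) x)) \<and> op_invertible T}"

text \<open>The inverse of \<open>T - c\<close> is written pointwise.\<close>

definition op_spectrum :: "('a::complex_hilbert_space \<Rightarrow>\<^sub>L 'a) \<Rightarrow> complex set" where
  "op_spectrum T = {c. \<not> (\<exists>S\<in>bounded_ops. \<forall>x.
     blinfun_apply S (blinfun_apply T x - c *\<^sub>C x) = x \<and>
     blinfun_apply T (blinfun_apply S x) - c *\<^sub>C blinfun_apply S x = x)}"

definition op_poly :: "real poly \<Rightarrow> ('a::complex_hilbert_space \<Rightarrow>\<^sub>L 'a) \<Rightarrow> ('a \<Rightarrow>\<^sub>L 'a)" where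
  "op_poly p T = (\<Sum>i\<le>degree p. coeff p i *\<^sub>R (((o\<^sub>L) T ^^ i) id_blinfun))"

text \<open>
  Continuous functional calculus for a self-adjoint \<open>T\<close> (whose spectrum is real) and a
  real function \<open>f\<close> continuous on the spectrum: \<open>f(T)\<close> is the norm limit of \<open>p\<^sub>n(T)\<close> for
  any real polynomials \<open>p\<^sub>n\<close> converging to \<open>f\<close> uniformly on the spectrum. For other \<open>T\<close>
  or \<open>f\<close> the value is of no significance.
\<close>

definition cfc :: "(real \<Rightarrow> real) \<Rightarrow> ('a::complex_hilbert_space \<Rightarrow>\<^sub>L 'a) \<Rightarrow> ('a \<Rightarrow>\<^sub>L 'a)" where
  "cfc f T = (THE S. \<forall>p :: nat \<Rightarrow> real poly.
     uniform_limit {t. complex_of_real t \<in> op_spectrum T} (\<lambda>n. poly (p n)) f sequentially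
       \<longrightarrow> (\<lambda>n. op_poly (p n) T) \<longlonglongrightarrow> S)"

definition op_powr :: "('a::complex_hilbert_space \<Rightarrow>\<^sub>L 'a) \<Rightarrow> real \<Rightarrow> ('a \<Rightarrow>\<^sub>L 'a)" where
  "op_powr T r = cfc (\<lambda>t. t powr r) T"

text \<open>\<open>A\<^sup>1\<^sup>/\<^sup>2 F(A\<^sup>-\<^sup>1\<^sup>/\<^sup>2 B A\<^sup>-\<^sup>1\<^sup>/\<^sup>2) A\<^sup>1\<^sup>/\<^sup>2\<close>\<close>

definition op_mean ::
  "(real \<Rightarrow> real) \<Rightarrow> ('a::complex_hilbert_space \<Rightarrow>\<^sub>L 'a) \<Rightarrow> ('a \<Rightarrow>\<^sub>L 'a) \<Rightarrow> ('a \<Rightarrow>\<^sub>L 'a)" where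
  "op_mean F A B =
     op_powr A (1/2) o\<^sub>L cfc F (op_powr A (-1/2) o\<^sub>L B o\<^sub>L op_powr A (-1/2)) o\<^sub>L op_powr A (1/2)"

definition op_arith_mean ::
  "real \<Rightarrow> ('a::complex_hilbert_space \<Rightarrow>\<^sub>L 'a) \<Rightarrow> ('a \<Rightarrow>\<^sub>L 'a) \<Rightarrow> ('a \<Rightarrow>\<^sub>L 'a)" where
  "op_arith_mean v A B = (1 - v) *\<^sub>R A + v *\<^sub>R B"

definition op_geom_mean ::
  "real \<Rightarrow> ('a::complex_hilbert_space \<Rightarrow>\<^sub>L 'a) \<Rightarrow> ('a \<Rightarrow>\<^sub>L 'a) \<Rightarrow> ('a \<Rightarrow>\<^sub>L 'a)" where
  "op_geom_mean v A B = op_mean (\<lambda>x. x powr v) A B"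

definition arith_mean :: "real \<Rightarrow> real \<Rightarrow> real \<Rightarrow> real" where
  "arith_mean v a b = (1 - v) * a + v * b"

definition log_mean :: "real \<Rightarrow> real \<Rightarrow> real \<Rightarrow> real" where
  "log_mean v a b =
     (if v = 0 then a else if v = 1 then b else if a = b then a
      else 1 / (ln a - ln b) *
        ((1 - v) / v * (a - a powr (1 - v) * b powr v)
          + v / (1 - v) * (a powr (1 - v) * b powr v - b)))"

definition identric_mean :: "real \<Rightarrow> real \<Rightarrow> real \<Rightarrow> real" where
  "identric_mean v a b =
     (if v = 0 then a else if v = 1 then b else if a = b then a
      else 1 / exp 1 *
        arith_mean v a b powr ((1 - 2 * v) * arith_mean v a b / (v * (1 - v) * (b - a))) *
        (b powr (v * b / (1 - v)) / a powr ((1 - v) * a / v)) powr (1 / (b - a)))"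

definition op_log_mean ::
  "real \<Rightarrow> ('a::complex_hilbert_space \<Rightarrow>\<^sub>L 'a) \<Rightarrow> ('a \<Rightarrow>\<^sub>L 'a) \<Rightarrow> ('a \<Rightarrow>\<^sub>L 'a)" where
  "op_log_mean v A B = op_mean (\<lambda>x. log_mean v 1 x) A B"

definition op_identric_mean ::
  "real \<Rightarrow> ('a::complex_hilbert_space \<Rightarrow>\<^sub>L 'a) \<Rightarrow> ('a \<Rightarrow>\<^sub>L 'a) \<Rightarrow> ('a \<Rightarrow>\<^sub>L 'a)" where
  "op_identric_mean v A B = op_mean (\<lambda>x. identric_mean v 1 x) A B"

end

theory Submission
  imports Defs "HOL-Computational_Algebra.Fundamental_Theorem_Algebra"
begin

text \<open>
  Put \<open>K = A\<^sup>1\<^sup>/\<^sup>2\<close> and \<open>Y = A\<^sup>-\<^sup>1\<^sup>/\<^sup>2 B A\<^sup>-\<^sup>1\<^sup>/\<^sup>2\<close>, so that \<open>A = K 1(Y) K\<close> and \<open>B = K id(Y) K\<close>.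
  For positive \<open>h, k\<close>, the \<open>F\<close>-mean of \<open>K h(Y) K\<close> and \<open>K k(Y) K\<close> is
  \<open>K (h \<cdot> F(k/h))(Y) K\<close>, so every operator in the theorem has the form \<open>K f(Y) K\<close> and the two
  claims become scalar identities on \<open>(0, \<infinity>)\<close>. Functional calculus is available because
  \<open>\<parallel>p(T)\<parallel> \<le> sup \<bar>p\<bar>\<close> over the spectrum of a self-adjoint \<open>T\<close>: one of \<open>\<plusminus>\<parallel>p(T)\<parallel>\<close> is a spectral
  value \<open>c\<close> of \<open>p(T)\<close>, and factoring \<open>p - c\<close> into real linear and quadratic factors shows
  \<open>c = p(t)\<close> for some \<open>t\<close> in the spectrum of \<open>T\<close>.
\<close>

section \<open>Hilbert space operators\<close>

lemma cinner_add_right: "cinner x (y + z) = cinner x y + cinner (x::'a::complex_hilbert_space) z"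
  by (metis cinner_add_left cinner_commute complex_cnj_add)

lemma cinner_scaleC_right: "cinner x (c *\<^sub>C y) = cnj c * cinner (x::'a::complex_hilbert_space) y"
  by (metis cinner_scaleC_left cinner_commute complex_cnj_mult)

lemma cinner_scaleR_left: "cinner (r *\<^sub>R x) y = of_real r * cinner (x::'a::complex_hilbert_space) y"
  by (metis cinner_scaleC_left scaleC_of_real)

lemma cinner_scaleR_right: "cinner x (r *\<^sub>R y) = of_real r * cinner (x::'a::complex_hilbert_space) y"
  by (metis cinner_scaleC_right scaleC_of_real complex_cnj_complex_of_real)

lemma Re_cinner_commute: "Re (cinner x y) = Re (cinner y (x::'a::complex_hilbert_space))"
  by (subst cinner_commute) simp

lemma Re_cinner_self: "Re (cinner x x) = (norm (x::'a::complex_hilbert_space))\<^sup>2"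
  by (simp add: cinner_self)

lemma norm_add_power2:
  "(norm (x + y))\<^sup>2 = (norm x)\<^sup>2 + 2 * Re (cinner x y) + (norm (y::'a::complex_hilbert_space))\<^sup>2"
  using Re_cinner_commute[of x y]
  by (simp add: Re_cinner_self[symmetric] cinner_add_left cinner_add_right)

text \<open>The class inherits the triangle inequality from its norm; squaring it and cancelling the
  two squares leaves this half of Cauchy-Schwarz.\<close>

lemma Re_cinner_le: "Re (cinner x y) \<le> norm x * norm (y::'a::complex_hilbert_space)"
proof -
  have "(norm (x + y))\<^sup>2 \<le> (norm x + norm y)\<^sup>2"
    by (intro power_mono norm_triangle_ineq norm_ge_zero)
  then show ?thesis
    by (simp add: norm_add_power2 power2_sum)
qed

lemma norm_scaleC: "norm (c *\<^sub>C x) = cmod c * norm (x::'a::complex_hilbert_space)"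
proof -
  have "complex_of_real ((norm (c *\<^sub>C x))\<^sup>2) = complex_of_real ((cmod c * norm x)\<^sup>2)"
    by (simp add: cinner_self[symmetric] cinner_scaleC_left cinner_scaleC_right
        power_mult_distrib complex_norm_square mult.assoc[symmetric] del: of_real_power)
  then show ?thesis
    by (simp only: of_real_eq_iff power2_eq_iff_nonneg norm_ge_zero mult_nonneg_nonneg)
qed

text \<open>Replacing \<open>x\<close> by \<open>cnj ?z *\<^sub>C x\<close> turns its inner product
  with \<open>y\<close> into the real number \<open>(cmod ?z)^2\<close>, so the bound on real parts
  suffices.\<close>

lemma norm_cinner_le: "cmod (cinner x y) \<le> norm x * norm (y::'a::complex_hilbert_space)"
proof -
  let ?z = "cinner x y"
  have "(cmod ?z)\<^sup>2 = Re (cinner (cnj ?z *\<^sub>C x) y)"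
    by (metis Re_complex_of_real cinner_scaleC_left complex_norm_square mult.commute)
  also have "\<dots> \<le> norm (cnj ?z *\<^sub>C x) * norm y"
    by (rule Re_cinner_le)
  also have "\<dots> = cmod ?z * (norm x * norm y)"
    by (simp add: norm_scaleC)
  finally show ?thesis
    by (cases "cmod ?z = 0") (auto simp: power2_eq_square)
qed

lemma bounded_bilinear_cinner:
  "bounded_bilinear (cinner :: 'a::complex_hilbert_space \<Rightarrow> 'a \<Rightarrow> complex)"
  by unfold_locales
    (auto simp: cinner_add_left cinner_add_right cinner_scaleR_left cinner_scaleR_right
      scaleR_conv_of_real intro!: exI[of _ 1] norm_cinner_le)

interpretation cinner: bounded_bilinear "cinner :: 'a::complex_hilbert_space \<Rightarrow> 'a \<Rightarrow> complex"
  by (rule bounded_bilinear_cinner)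

lemma norm_diff_power2:
  "(norm (x - y))\<^sup>2 = (norm x)\<^sup>2 - 2 * Re (cinner x y) + (norm (y::'a::complex_hilbert_space))\<^sup>2"
  using norm_add_power2[of x "- y"] by (simp add: cinner.minus_right)

lemma bounded_linear_scaleC: "bounded_linear (\<lambda>x::'a::complex_hilbert_space. c *\<^sub>C x)"
proof (rule bounded_linear_intro[where K = "cmod c"])
  fix r and x :: 'a
  show "c *\<^sub>C (r *\<^sub>R x) = r *\<^sub>R (c *\<^sub>C x)"
    by (metis scaleC_of_real scaleC_scaleC mult.commute)
qed (simp_all add: scaleC_add_right norm_scaleC mult.commute)

lemmas scaleC_scaleR_commute = linear_scale[OF bounded_linear.linear[OF bounded_linear_scaleC]]
lemmas scaleC_zero_right = linear_0[OF bounded_linear.linear[OF bounded_linear_scaleC]]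
lemmas scaleC_diff_right = linear_diff[OF bounded_linear.linear[OF bounded_linear_scaleC]]

section \<open>Closure properties of complex-linear and of self-adjoint operators\<close>

lemma blinfun_eq_iff: "f = g \<longleftrightarrow> (\<forall>x. blinfun_apply f x = blinfun_apply g x)"
  by (auto intro: blinfun_eqI)

lemma bounded_ops_apply: "T \<in> bounded_ops \<Longrightarrow> blinfun_apply T (c *\<^sub>C x) = c *\<^sub>C blinfun_apply T x"
  by (simp add: bounded_ops_def)

lemma id_bounded_ops: "id_blinfun \<in> bounded_ops"
  by (simp add: bounded_ops_def)

lemma zero_bounded_ops: "(0 :: 'a::complex_hilbert_space \<Rightarrow>\<^sub>L 'a) \<in> bounded_ops"
  by (simp add: bounded_ops_def scaleC_zero_right)

lemma compose_bounded_ops: "S \<in> bounded_ops \<Longrightarrow> T \<in> bounded_ops \<Longrightarrow> S o\<^sub>L T \<in> bounded_ops"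
  by (simp add: bounded_ops_def)

lemma add_bounded_ops: "S \<in> bounded_ops \<Longrightarrow> T \<in> bounded_ops \<Longrightarrow> S + T \<in> bounded_ops"
  by (simp add: bounded_ops_def blinfun.add_left scaleC_add_right)

lemma scaleR_bounded_ops: "S \<in> bounded_ops \<Longrightarrow> r *\<^sub>R S \<in> bounded_ops"
  by (simp add: bounded_ops_def blinfun.scaleR_left scaleC_scaleR_commute)

lemma diff_bounded_ops: "S \<in> bounded_ops \<Longrightarrow> T \<in> bounded_ops \<Longrightarrow> S - T \<in> bounded_ops"
  by (simp add: bounded_ops_def blinfun.diff_left scaleC_diff_right)

lemmas bounded_ops_intros = id_bounded_ops zero_bounded_ops compose_bounded_ops add_bounded_ops
  scaleR_bounded_ops diff_bounded_ops

lemma tendsto_bounded_ops: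
  assumes "X \<longlonglongrightarrow> S" and "\<And>n. X n \<in> bounded_ops"
  shows "S \<in> bounded_ops"
proof -
  have *: "(\<lambda>n. blinfun_apply (X n) x) \<longlonglongrightarrow> blinfun_apply S x" for x
    by (intro tendsto_intros assms)
  have "blinfun_apply S (c *\<^sub>C x) = c *\<^sub>C blinfun_apply S x" for c x
    using LIMSEQ_unique[OF *[of "c *\<^sub>C x"]] bounded_linear.tendsto[OF bounded_linear_scaleC *]
    by (simp add: bounded_ops_apply[OF assms(2)])
  then show ?thesis
    by (simp add: bounded_ops_def)
qed

lemma self_adjointD: "self_adjoint T \<Longrightarrow> cinner (blinfun_apply T x) y = cinner x (blinfun_apply T y)"
  by (simp add: self_adjoint_def)

lemma tendsto_self_adjoint:
  assumes "X \<longlonglongrightarrow> S" and "\<And>n. self_adjoint (X n)"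
  shows "self_adjoint S"
  unfolding self_adjoint_def
proof (intro allI)
  fix x y
  have *: "(\<lambda>n. blinfun_apply (X n) x) \<longlonglongrightarrow> blinfun_apply S x" for x
    by (intro tendsto_intros assms)
  show "cinner (blinfun_apply S x) y = cinner x (blinfun_apply S y)"
    using LIMSEQ_unique[OF cinner.tendsto[OF *[of x] tendsto_const[of y]]]
      cinner.tendsto[OF tendsto_const[of x] *[of y]]
    by (simp add: self_adjointD[OF assms(2)])
qed

section \<open>Invertibility and the real spectrum\<close>

lemma op_invertible_compose:
  assumes "op_invertible S" and "op_invertible T"
  shows "op_invertible (S o\<^sub>L T)"
proof -
  obtain S' T' where "S' \<in> bounded_ops" "S' o\<^sub>L S = id_blinfun" "S o\<^sub>L S' = id_blinfun"
    and "T' \<in> bounded_ops" "T' o\<^sub>L T = id_blinfun" "T o\<^sub>L T' = id_blinfun"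
    using assms by (auto simp: op_invertible_def)
  moreover from this have "S' (S x) = x" "S (S' x) = x" "T' (T x) = x" "T (T' x) = x" for x
    by (metis blinfun_apply_blinfun_compose blinfun_apply_id_blinfun)+
  ultimately show ?thesis
    unfolding op_invertible_def
    by (intro bexI[of _ "T' o\<^sub>L S'"]) (auto intro!: blinfun_eqI compose_bounded_ops)
qed

text \<open>Moves real spectral values from the pointwise definition with complex scaling into the
  real algebra of operators, where all later spectral arguments take place.\<close>

lemma Re_op_spectrum_iff:
  fixes T :: "'a::complex_hilbert_space \<Rightarrow>\<^sub>L 'a"
  shows "complex_of_real c \<in> op_spectrum T \<longleftrightarrow> \<not> op_invertible (T - c *\<^sub>R id_blinfun)"
proof -
  have "(\<forall>x. S (T x - of_real c *\<^sub>C x) = x \<and> T (S x) - of_real c *\<^sub>C S x = x) \<longleftrightarrow>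
      S o\<^sub>L (T - c *\<^sub>R id_blinfun) = id_blinfun \<and> (T - c *\<^sub>R id_blinfun) o\<^sub>L S = id_blinfun"
    for S :: "'a \<Rightarrow>\<^sub>L 'a"
    by (simp add: blinfun_eq_iff scaleC_of_real blinfun.diff_left blinfun.scaleR_left all_conj_distrib)
  then show ?thesis
    by (simp only: op_spectrum_def op_invertible_def mem_Collect_eq)
qed

text \<open>
  Lax--Milgram: for a small step \<open>\<tau>\<close> the map \<open>x \<mapsto> x - \<tau> (S x - y)\<close> is a contraction, and
  its fixed point solves \<open>S x = y\<close>.
\<close>

lemma coercive_op_invertible:
  fixes S :: "'a::complex_hilbert_space \<Rightarrow>\<^sub>L 'a"
  assumes S: "S \<in> bounded_ops" and "d > 0"
    and coercive: "\<And>x. d * (norm x)\<^sup>2 \<le> Re (cinner (S x) x)"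
  shows "op_invertible S"
proof -
  \<comment> \<open>Adding \<open>d\<close> to the norm keeps \<open>M\<close> positive and at least
    \<open>d\<close>, so \<open>d^2 / M^2\<close> is at most 1 and \<open>k\<close> is a real
    root.\<close>
  define M where "M = norm S + d"
  have M: "M > 0" "d \<le> M" "\<And>x. norm (S x) \<le> M * norm x"
    using \<open>d > 0\<close> by (auto simp: M_def add_nonneg_pos distrib_right norm_blinfun add_increasing2)
  \<comment> \<open>This step size minimizes \<open>1 - 2 * \<tau> * d + \<tau>^2 * M^2\<close>,
    with minimum \<open>1 - d^2 / M^2\<close>.\<close>
  define \<tau> where "\<tau> = d / M\<^sup>2"
  define k where "k = sqrt (1 - d\<^sup>2 / M\<^sup>2)"
  have dM: "d\<^sup>2 / M\<^sup>2 \<le> 1" "d\<^sup>2 / M\<^sup>2 > 0"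
    using M \<open>d > 0\<close> by (auto simp: power_mono)
  have k: "0 \<le> k" "k < 1"
    using dM by (auto simp: k_def)
  have "\<tau> > 0"
    using M \<open>d > 0\<close> by (simp add: \<tau>_def)
  have contr: "norm (u - \<tau> *\<^sub>R S u) \<le> k * norm u" for u
  proof (rule power2_le_imp_le)
    have "(norm (u - \<tau> *\<^sub>R S u))\<^sup>2 = (norm u)\<^sup>2 - 2 * \<tau> * Re (cinner (S u) u) + \<tau>\<^sup>2 * (norm (S u))\<^sup>2"
      using \<open>\<tau> > 0\<close> Re_cinner_commute[of u "S u"]
      by (simp add: norm_diff_power2 cinner_scaleR_right power_mult_distrib)
    also have "\<dots> \<le> (norm u)\<^sup>2 - 2 * \<tau> * (d * (norm u)\<^sup>2) + \<tau>\<^sup>2 * (M * norm u)\<^sup>2"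
      using \<open>\<tau> > 0\<close> by (intro add_mono diff_mono mult_left_mono power_mono coercive M) auto
    also have "\<dots> = (1 - d\<^sup>2 / M\<^sup>2) * (norm u)\<^sup>2"
      using M by (simp add: \<tau>_def field_simps power2_eq_square)
    finally show "(norm (u - \<tau> *\<^sub>R S u))\<^sup>2 \<le> (k * norm u)\<^sup>2"
      using dM by (simp add: k_def power_mult_distrib)
  qed (use k in simp)
  have surj: "\<exists>x. S x = y" for y
  proof -
    have "dist (x - \<tau> *\<^sub>R (S x - y)) (x' - \<tau> *\<^sub>R (S x' - y)) \<le> k * dist x x'" for x x'
      using contr[of "x - x'"] by (simp add: dist_norm blinfun.diff_right algebra_simps)
    then obtain x where "x - \<tau> *\<^sub>R (S x - y) = x"
      using banach_fix_type[OF k, of "\<lambda>x. x - \<tau> *\<^sub>R (S x - y)"] by auto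
    then show ?thesis
      using \<open>\<tau> > 0\<close> by auto
  qed
  \<comment> \<open>Coercivity and Cauchy-Schwarz bound \<open>S\<close> from below; this gives
    injectivity and the bound \<open>1 / d\<close> on the inverse.\<close>
  have below: "d * norm x \<le> norm (S x)" for x
    using order_trans[OF coercive Re_cinner_le, of x]
    by (cases "norm x = 0") (auto simp: power2_eq_square)
  have inj: "x = y" if "S x = S y" for x y
    using below[of "x - y"] that \<open>d > 0\<close> by (simp add: blinfun.diff_right mult_le_0_iff)
  define g where "g = inv (blinfun_apply S)"
  have Sg: "S (g y) = y" for y
    unfolding g_def by (metis surj f_inv_into_f rangeI)
  have gS: "g (S x) = x" for x
    using inj Sg by blast
  have "bounded_linear g"
  proof (rule bounded_linear_intro[where K = "1 / d"])
    show "norm (g x) \<le> norm x * (1 / d)" for x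
      using below[of "g x"] \<open>d > 0\<close> by (simp add: Sg field_simps)
  qed (rule inj, simp add: Sg blinfun.add_right blinfun.scaleR_right)+
  then have apply_g: "blinfun_apply (Blinfun g) = g"
    by (rule bounded_linear_Blinfun_apply)
  have "Blinfun g \<in> bounded_ops"
    unfolding bounded_ops_def using inj by (auto simp: apply_g Sg bounded_ops_apply[OF S])
  then show ?thesis
    unfolding op_invertible_def
    by (intro bexI[of _ "Blinfun g"]) (auto intro!: blinfun_eqI simp: apply_g Sg gS)
qed

text \<open>If \<open>S - m\<close> and \<open>S + m\<close> were both invertible for
  \<open>m = norm S\<close>, then \<open>S^2 - m^2\<close> would have a bounded left inverse. For
  self-adjoint \<open>S\<close> this keeps \<open>norm (S x)\<close> below a fixed fraction of
  \<open>m * norm x\<close>, contradicting the choice of \<open>m\<close>.\<close>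

lemma self_adjoint_norm_spectrum:
  fixes S :: "'a::complex_hilbert_space \<Rightarrow>\<^sub>L 'a"
  assumes sa: "self_adjoint S" and "\<exists>x::'a. x \<noteq> 0"
  obtains c where "\<bar>c\<bar> = norm S" and "\<not> op_invertible (S - c *\<^sub>R id_blinfun)"
proof (rule ccontr)
  assume "\<not> thesis"
  define m where "m = norm S"
  have m: "norm (S x) \<le> m * norm x" for x
    by (simp add: m_def norm_blinfun)
  have "m \<ge> 0"
    by (simp add: m_def)
  have "op_invertible (S - m *\<^sub>R id_blinfun)" "op_invertible (S - (- m) *\<^sub>R id_blinfun)"
    using that \<open>\<not> thesis\<close> \<open>m \<ge> 0\<close> unfolding m_def by (metis abs_minus_cancel abs_of_nonneg)+
  from op_invertible_compose[OF this] obtain V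
    where V: "V o\<^sub>L ((S - m *\<^sub>R id_blinfun) o\<^sub>L (S - (- m) *\<^sub>R id_blinfun)) = id_blinfun"
    by (auto simp: op_invertible_def)
  have VS: "V (S (S x) - m\<^sup>2 *\<^sub>R x) = x" for x
    using arg_cong[OF V, of "\<lambda>T. blinfun_apply T x"]
    by (simp add: blinfun.bilinear_simps power2_eq_square scaleR_diff_right)
  define k where "k = (norm V)\<^sup>2 * m\<^sup>2"
  have bound: "(norm x)\<^sup>2 \<le> k * (m\<^sup>2 * (norm x)\<^sup>2 - (norm (S x))\<^sup>2)" for x
  proof -
    have "norm x \<le> norm V * norm (S (S x) - m\<^sup>2 *\<^sub>R x)"
      using norm_blinfun[of V] by (metis VS)
    then have "(norm x)\<^sup>2 \<le> (norm V)\<^sup>2 * (norm (S (S x) - m\<^sup>2 *\<^sub>R x))\<^sup>2"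
      by (metis power_mono norm_ge_zero power_mult_distrib)
    \<comment> \<open>In the expansion, self-adjointness turns the inner product of
      \<open>S (S x)\<close> with \<open>x\<close> into the squared norm of
      \<open>S x\<close>.\<close>
    also have "(norm (S (S x) - m\<^sup>2 *\<^sub>R x))\<^sup>2
        = (norm (S (S x)))\<^sup>2 - 2 * m\<^sup>2 * (norm (S x))\<^sup>2 + m^4 * (norm x)\<^sup>2"
      by (simp add: norm_diff_power2 cinner_scaleR_right self_adjointD[OF sa, of "S x"]
          Re_cinner_self power_mult_distrib)
    also have "\<dots> \<le> (m * norm (S x))\<^sup>2 - 2 * m\<^sup>2 * (norm (S x))\<^sup>2 + m^4 * (norm x)\<^sup>2"
      using m[of "S x"] by (simp add: power_mono)
    also have "\<dots> = m\<^sup>2 * (m\<^sup>2 * (norm x)\<^sup>2 - (norm (S x))\<^sup>2)"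
      by (simp add: power2_eq_square power4_eq_xxxx algebra_simps)
    finally show ?thesis
      by (simp add: k_def mult_left_mono mult.assoc)
  qed
  \<comment> \<open>A nonzero vector excludes \<open>k = 0\<close>, covering also the case
    \<open>m = 0\<close>, and later shows that \<open>e\<close> has a real square root.\<close>
  obtain x0 :: 'a where "norm x0 > 0"
    using assms(2) by auto
  then have "k \<noteq> 0"
    using bound[of x0] by auto
  then have "k > 0"
    by (simp add: k_def less_le)
  define e where "e = m\<^sup>2 - 1 / k"
  have m_bound: "(norm (S x))\<^sup>2 \<le> e * (norm x)\<^sup>2" for x
    using bound[of x] \<open>k > 0\<close> by (simp add: e_def field_simps)
  have "0 \<le> e * (norm x0)\<^sup>2"
    using m_bound[of x0] by (meson order_trans zero_le_power2)
  then have "e \<ge> 0"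
    using \<open>norm x0 > 0\<close> by (simp add: zero_le_mult_iff)
  have "norm S \<le> sqrt e"
  proof (rule norm_blinfun_bound)
    show "norm (S x) \<le> sqrt e * norm x" for x
      using \<open>e \<ge> 0\<close> m_bound[of x]
      by - (rule power2_le_imp_le, simp_all add: power_mult_distrib)
  qed (use \<open>e \<ge> 0\<close> in simp)
  then have "m\<^sup>2 \<le> (sqrt e)\<^sup>2"
    unfolding m_def by (intro power_mono norm_ge_zero)
  also have "\<dots> = m\<^sup>2 - 1 / k"
    unfolding e_def[symmetric] using \<open>e \<ge> 0\<close> by (rule real_sqrt_pow2)
  finally have "1 / k \<le> 0"
    by linarith
  with \<open>k > 0\<close> show False
    by simp
qed

section \<open>Polynomials of a self-adjoint operator\<close>

text \<open>Padding with zero coefficients lets \<open>pCons a p\<close> be summed up to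
  \<open>Suc (degree p)\<close> even when \<open>p = 0\<close>, where its degree is smaller than
  that.\<close>

lemma op_poly_eq_sum:
  assumes "degree p \<le> n"
  shows "op_poly p T = (\<Sum>i\<le>n. coeff p i *\<^sub>R (((o\<^sub>L) T ^^ i) id_blinfun))"
  unfolding op_poly_def using assms
  by (intro sum.mono_neutral_left) (auto simp: coeff_eq_0)

lemma op_poly_0 [simp]: "op_poly 0 T = 0"
  by (simp add: op_poly_def)

text \<open>Horner's recursion: it replaces the defining sum in the inductions on polynomials
  below.\<close>

lemma op_poly_pCons: "op_poly (pCons a p) T = a *\<^sub>R id_blinfun + (T o\<^sub>L op_poly p T)"
proof -
  have "op_poly (pCons a p) T
      = (\<Sum>i\<le>Suc (degree p). coeff (pCons a p) i *\<^sub>R (((o\<^sub>L) T ^^ i) id_blinfun))"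
    by (rule op_poly_eq_sum) (rule degree_pCons_le)
  also have "\<dots> = a *\<^sub>R id_blinfun + (T o\<^sub>L op_poly p T)"
    unfolding sum.atMost_Suc_shift op_poly_def
    by (simp add: blinfun.bilinear_simps bounded_bilinear.sum_right[OF bounded_bilinear_blinfun_compose]
        bounded_bilinear.scaleR_right[OF bounded_bilinear_blinfun_compose])
  finally show ?thesis .
qed

lemmas op_simps = blinfun_eq_iff blinfun.bilinear_simps scaleR_add_right scaleR_diff_right
  scaleR_diff_left scaleR_add_left

lemma op_poly_add: "op_poly (p + q) T = op_poly p T + op_poly q T"
  by (induction p q rule: poly_induct2) (simp_all add: op_poly_pCons op_simps)

lemma op_poly_smult: "op_poly (smult c p) T = c *\<^sub>R op_poly p T"
  by (induction p) (simp_all add: op_poly_pCons op_simps)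

lemma op_poly_diff: "op_poly (p - q) T = op_poly p T - op_poly q T"
  using op_poly_add[of p "smult (- 1) q" T] op_poly_smult[of "- 1" q T] by simp

lemma op_poly_mult: "op_poly (p * q) T = op_poly p T o\<^sub>L op_poly q T"
  by (induction p) (simp_all add: op_poly_pCons op_poly_add op_poly_smult op_simps)

lemma op_poly_commute: "op_poly p T o\<^sub>L op_poly q T = op_poly q T o\<^sub>L op_poly p T"
  by (metis op_poly_mult mult.commute)

lemma op_poly_const [simp]: "op_poly [:c:] T = c *\<^sub>R id_blinfun"
  by (simp add: op_poly_pCons op_simps)

lemma op_poly_X [simp]: "op_poly [:0, 1:] T = T"
  by (simp add: op_poly_pCons op_simps)

lemma op_poly_bounded_ops: "T \<in> bounded_ops \<Longrightarrow> op_poly p T \<in> bounded_ops"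
  by (induction p) (simp_all add: op_poly_pCons bounded_ops_intros)

lemma op_poly_self_adjoint:
  fixes T :: "'a::complex_hilbert_space \<Rightarrow>\<^sub>L 'a"
  assumes "self_adjoint T"
  shows "self_adjoint (op_poly p T)"
proof (induction p)
  case 0
  then show ?case
    by (simp add: self_adjoint_def cinner.zero_left cinner.zero_right)
next
  case (pCons a p)
  \<comment> \<open>A product of self-adjoint operators is self-adjoint when the factors
    commute.\<close>
  have "T (op_poly p T x) = op_poly p T (T x)" for x
    using op_poly_commute[of "[:0, 1:]" T p] by (simp add: blinfun_eq_iff)
  then show ?case
    using pCons assms
    by (simp add: op_poly_pCons self_adjoint_def blinfun.bilinear_simps cinner_add_left
        cinner_add_right cinner_scaleR_left cinner_scaleR_right)
qed

lemma op_invertible_scaleR_id: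
  assumes "c \<noteq> 0"
  shows "op_invertible (c *\<^sub>R id_blinfun)"
  unfolding op_invertible_def using assms
  by (intro bexI[of _ "(1 / c) *\<^sub>R id_blinfun"]) (simp_all add: op_simps bounded_ops_intros)

abbreviation real_spectrum :: "('a::complex_hilbert_space \<Rightarrow>\<^sub>L 'a) \<Rightarrow> real set" where
  "real_spectrum T \<equiv> {t. complex_of_real t \<in> op_spectrum T}"

section \<open>Real factors of real polynomials\<close>

lemma map_poly_of_real_add:
  "map_poly of_real (p + q) = map_poly of_real p + map_poly (of_real :: real \<Rightarrow> complex) q"
  by (rule poly_eqI) (simp add: coeff_map_poly)

lemma map_poly_of_real_mult:
  "map_poly of_real (p * q) = map_poly of_real p * map_poly (of_real :: real \<Rightarrow> complex) q"
  by (induction p) (simp_all add: map_poly_pCons map_poly_of_real_add map_poly_smult)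

lemma poly_map_poly_of_real:
  "poly (map_poly of_real p) (complex_of_real x) = complex_of_real (poly p x)"
  by (induction p) (simp_all add: map_poly_pCons)

text \<open>The fundamental theorem of algebra supplies a complex root. A real root gives a linear
  factor; a nonreal root \<open>a + i b\<close> gives the quadratic \<open>(t - a)^2 + b^2\<close>,
  whose roots are it and its conjugate.\<close>

lemma real_poly_factor:
  fixes q :: "real poly"
  assumes "degree q \<noteq> 0"
  obtains a where "poly q a = 0" "[:- a, 1:] dvd q"
  | a b where "b \<noteq> 0" "[:a\<^sup>2 + b\<^sup>2, - 2 * a, 1:] dvd q"
proof -
  define Q where "Q = map_poly complex_of_real q"
  have "degree Q \<noteq> 0"
    using assms by (simp add: Q_def degree_map_poly)
  then obtain z where z: "poly Q z = 0"
    using fundamental_theorem_of_algebra[of Q] by (auto simp: constant_degree)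
  show ?thesis
  proof (cases "Im z = 0")
    case True
    then have "z = complex_of_real (Re z)"
      by (simp add: complex_eq_iff)
    then have "poly q (Re z) = 0"
      using z poly_map_poly_of_real[of q "Re z"] by (simp add: Q_def)
    then show ?thesis
      using that(1) by (simp add: poly_eq_0_iff_dvd)
  next
    case False
    define a b where "a = Re z" and "b = Im z"
    define r where "r = [:a\<^sup>2 + b\<^sup>2, - 2 * a, 1:]"
    \<comment> \<open>The remainder is a real polynomial \<open>c + d * t\<close> vanishing at the
      nonreal point \<open>z\<close>; the imaginary part forces \<open>d = 0\<close>, then
      \<open>c = 0\<close>.\<close>
    have "degree (q mod r) < 2"
      using degree_mod_less[of r q] by (auto simp: r_def)
    then obtain c d where cd: "q mod r = [:c, d:]"
      by (metis degree1_coeffs degree_eq_zeroE less_2_cases_iff One_nat_def pCons_0_0)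
    have zr: "poly (map_poly complex_of_real r) z = 0"
      by (simp add: r_def a_def b_def map_poly_pCons complex_eq_iff power2_eq_square algebra_simps)
    have "poly Q z = poly (map_poly of_real (r * (q div r) + [:c, d:])) z"
      by (simp add: Q_def cd[symmetric])
    also have "\<dots> = poly (map_poly complex_of_real [:c, d:]) z"
      using zr by (simp add: map_poly_of_real_add map_poly_of_real_mult)
    finally have "poly Q z = poly (map_poly complex_of_real [:c, d:]) z" .
    then have "c = 0 \<and> d = 0"
      using z False by (auto simp: map_poly_pCons complex_eq_iff)
    then have "r dvd q"
      using cd by (simp add: dvd_eq_mod_eq_0)
    then show ?thesis
      using that(2)[of b a] False by (simp add: r_def b_def)
  qed
qed

text \<open>One half of the spectral mapping theorem, by splitting off factors. A linear factor is
  invertible because its root lies outside the spectrum, a quadratic one because it is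
  coercive.\<close>

lemma op_invertible_op_poly:
  fixes T :: "'a::complex_hilbert_space \<Rightarrow>\<^sub>L 'a"
  assumes T: "T \<in> bounded_ops" "self_adjoint T"
    and "q \<noteq> 0" and "\<And>t. t \<in> real_spectrum T \<Longrightarrow> poly q t \<noteq> 0"
  shows "op_invertible (op_poly q T)"
  using assms(3-)
proof (induction "degree q" arbitrary: q rule: less_induct)
  case less
  show ?case
  proof (cases "degree q = 0")
    case True
    then show ?thesis
      using \<open>q \<noteq> 0\<close> by (auto elim!: degree_eq_zeroE intro: op_invertible_scaleR_id)
  next
    case False
    then obtain r where r: "r dvd q" "degree r > 0" "op_invertible (op_poly r T)"
    proof (cases rule: real_poly_factor)
      case (1 a)
      then have "a \<notin> real_spectrum T"
        using less.prems(2) by blast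
      moreover have "op_poly [:- a, 1:] T = T - a *\<^sub>R id_blinfun"
        by (simp add: op_poly_pCons op_simps)
      ultimately have "op_invertible (op_poly [:- a, 1:] T)"
        by (simp add: Re_op_spectrum_iff)
      with that 1 show ?thesis
        by auto
    next
      case (2 a b)
      let ?r = "[:a\<^sup>2 + b\<^sup>2, - 2 * a, 1:]"
      \<comment> \<open>The factor evaluates to \<open>(T - a)^2 + b^2\<close>, and
        \<open>T - a\<close> is self-adjoint, so \<open>b^2\<close> is a coercivity
        constant.\<close>
      have "Re (cinner (op_poly ?r T x) x) = (norm (T x - a *\<^sub>R x))\<^sup>2 + b\<^sup>2 * (norm x)\<^sup>2" for x
        using self_adjointD[OF T(2), of "T x" x]
        by (simp add: op_poly_pCons norm_diff_power2 cinner_scaleR_left cinner_scaleR_right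
            cinner_add_left cinner.diff_left blinfun.bilinear_simps Re_cinner_self power_mult_distrib algebra_simps)
      then have "op_invertible (op_poly ?r T)"
        using 2 by (intro coercive_op_invertible[of _ "b\<^sup>2"] op_poly_bounded_ops T) auto
      with that[of ?r] 2 show ?thesis
        by auto
    qed
    then obtain q' where q': "q = r * q'"
      by blast
    have "degree q' < degree q"
      using r(2) \<open>q \<noteq> 0\<close> by (auto simp: q' degree_mult_eq)
    then have "op_invertible (op_poly q' T)"
      using less.prems by (intro less.hyps) (auto simp: q')
    with r(3) show ?thesis
      by (simp add: q' op_poly_mult op_invertible_compose)
  qed
qed

lemma norm_op_poly_le:
  fixes T :: "'a::complex_hilbert_space \<Rightarrow>\<^sub>L 'a"
  assumes T: "T \<in> bounded_ops" "self_adjoint T"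
    and C: "\<And>t. t \<in> real_spectrum T \<Longrightarrow> \<bar>poly p t\<bar> \<le> C" "0 \<le> C"
  shows "norm (op_poly p T) \<le> C"
proof (cases "\<exists>x::'a. x \<noteq> 0")
  case False
  then have "op_poly p T = 0"
    by (metis blinfun_eqI)
  with C show ?thesis
    by simp
next
  case True
  obtain c where c: "\<bar>c\<bar> = norm (op_poly p T)" "\<not> op_invertible (op_poly p T - c *\<^sub>R id_blinfun)"
    using self_adjoint_norm_spectrum[OF op_poly_self_adjoint[OF T(2)] True] by metis
  \<comment> \<open>If \<open>p - [:c:]\<close> is the zero polynomial, every point is a root, and
    the spectrum still has to provide one.\<close>
  obtain t0 where "t0 \<in> real_spectrum T"
    using self_adjoint_norm_spectrum[OF T(2) True] by (auto simp: Re_op_spectrum_iff)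
  have "\<not> op_invertible (op_poly (p - [:c:]) T)"
    using c by (simp add: op_poly_diff)
  then obtain t where "t \<in> real_spectrum T" "poly (p - [:c:]) t = 0"
    using op_invertible_op_poly[OF T, of "p - [:c:]"] \<open>t0 \<in> real_spectrum T\<close>
    by (metis poly_0)
  then show ?thesis
    using C(1)[of t] c(1) by simp
qed

section \<open>Continuous functional calculus of positive invertible operators\<close>

lemma pos_inv_opsD:
  assumes "T \<in> pos_inv_ops"
  shows "T \<in> bounded_ops" "self_adjoint T" "0 \<le> Re (cinner (T x) x)" "op_invertible T"
  using assms by (auto simp: pos_inv_ops_def)

text \<open>Positivity of the form bounds it below by a multiple of \<open>norm (T x)^2\<close>, and
  a bounded left inverse bounds \<open>norm (T x)\<close> below by a multiple of
  \<open>norm x\<close>.\<close>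

lemma pos_inv_coercive:
  fixes T :: "'a::complex_hilbert_space \<Rightarrow>\<^sub>L 'a"
  assumes T: "T \<in> pos_inv_ops"
  obtains d where "d > 0" "\<And>x. d * (norm x)\<^sup>2 \<le> Re (cinner (T x) x)"
proof -
  obtain V where V: "V o\<^sub>L T = id_blinfun"
    using pos_inv_opsD(4)[OF T] by (auto simp: op_invertible_def)
  define m n where "m = norm T + 1" and "n = norm V + 1"
  have mn: "m > 0" "n > 0"
    by (auto simp: m_def n_def add_nonneg_pos)
  have Tx: "(norm (T x))\<^sup>2 / m \<le> Re (cinner (T x) x)" for x
  proof -
    have "Re (cinner (T (T x)) (T x)) \<le> norm (T (T x)) * norm (T x)"
      by (rule Re_cinner_le)
    also have "\<dots> \<le> m * norm (T x) * norm (T x)"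
      using norm_blinfun[of T "T x"]
      by (intro mult_right_mono) (simp_all add: m_def distrib_right add_increasing2)
    finally have *: "Re (cinner (T (T x)) (T x)) / m\<^sup>2 \<le> (norm (T x))\<^sup>2 / m"
      using mn by (simp add: field_simps power2_eq_square)
    \<comment> \<open>Testing positivity at \<open>x - T x / m\<close> yields
      \<open>norm (T x)^2 / m\<close> once the quadratic term is absorbed by
      \<open>*\<close>.\<close>
    have "0 \<le> Re (cinner (T (x - (1 / m) *\<^sub>R T x)) (x - (1 / m) *\<^sub>R T x))"
      by (rule pos_inv_opsD(3)[OF T])
    also have "\<dots> = Re (cinner (T x) x) - 2 * ((norm (T x))\<^sup>2 / m) + Re (cinner (T (T x)) (T x)) / m\<^sup>2"
      using self_adjointD[OF pos_inv_opsD(2)[OF T], of "T x" x]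
      by (simp add: blinfun.bilinear_simps cinner.diff_left cinner.diff_right cinner_scaleR_left
          cinner_scaleR_right cinner_self power2_eq_square diff_divide_distrib)
    finally show ?thesis
      using * by linarith
  qed
  have "1 / (m * n\<^sup>2) * (norm x)\<^sup>2 \<le> Re (cinner (T x) x)" for x
  proof -
    have "norm (V (T x)) \<le> norm V * norm (T x)"
      by (rule norm_blinfun)
    also have "V (T x) = x"
      using V by (simp add: blinfun_eq_iff)
    also have "norm V * norm (T x) \<le> n * norm (T x)"
      by (intro mult_right_mono) (auto simp: n_def)
    finally have "(norm x)\<^sup>2 \<le> (n * norm (T x))\<^sup>2"
      by (intro power_mono) auto
    then have "1 / (m * n\<^sup>2) * (norm x)\<^sup>2 \<le> 1 / (m * n\<^sup>2) * (n * norm (T x))\<^sup>2"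
      using mn by (intro mult_left_mono) auto
    also have "\<dots> = (norm (T x))\<^sup>2 / m"
      using mn by (simp add: power_mult_distrib)
    finally show ?thesis
      using Tx[of x] by linarith
  qed
  moreover have "1 / (m * n\<^sup>2) > 0"
    using mn by simp
  ultimately show ?thesis
    using that by blast
qed

text \<open>Below the coercivity constant \<open>T - t\<close> is coercive, above the norm
  \<open>t - T\<close> is. Hence functions that are merely continuous on the open half-line, such as
  negative powers, are bounded on the spectrum.\<close>

lemma real_spectrum_pos_inv:
  fixes T :: "'a::complex_hilbert_space \<Rightarrow>\<^sub>L 'a"
  assumes T: "T \<in> pos_inv_ops"
  obtains a b where "0 < a" "real_spectrum T \<subseteq> {a..b}"
proof -
  obtain d where d: "d > 0" "\<And>x. d * (norm x)\<^sup>2 \<le> Re (cinner (T x) x)"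
    using pos_inv_coercive[OF T] by blast
  have "op_invertible (T - t *\<^sub>R id_blinfun)" if "t < d" for t
    using d(2) that
    by (intro coercive_op_invertible[of _ "d - t"] bounded_ops_intros pos_inv_opsD[OF T])
      (simp_all add: blinfun.bilinear_simps cinner.diff_left cinner_scaleR_left Re_cinner_self
        algebra_simps)
  moreover have "op_invertible (T - t *\<^sub>R id_blinfun)" if "t > norm T" for t
  proof -
    have "Re (cinner (T x) x) \<le> norm T * (norm x)\<^sup>2" for x
      using order_trans[OF Re_cinner_le mult_right_mono[OF norm_blinfun norm_ge_zero], of T x x]
      by (simp add: power2_eq_square)
    then have "op_invertible (t *\<^sub>R id_blinfun - T)"
      using that
      by (intro coercive_op_invertible[of _ "t - norm T"] bounded_ops_intros pos_inv_opsD[OF T])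
        (simp_all add: blinfun.bilinear_simps cinner.diff_left cinner_scaleR_left Re_cinner_self
          algebra_simps)
    then have "op_invertible ((- 1) *\<^sub>R id_blinfun o\<^sub>L (t *\<^sub>R id_blinfun - T))"
      by (intro op_invertible_compose op_invertible_scaleR_id) auto
    also have "(- 1) *\<^sub>R id_blinfun o\<^sub>L (t *\<^sub>R id_blinfun - T) = T - t *\<^sub>R id_blinfun"
      by (simp add: op_simps)
    finally show ?thesis .
  qed
  ultimately have "real_spectrum T \<subseteq> {d..norm T}"
    by (force simp: Re_op_spectrum_iff not_less[symmetric])
  with d that show ?thesis
    by blast
qed

section \<open>Weierstrass approximation on the spectrum\<close>

lemma polynomial_uniform_approx:
  fixes f :: "real \<Rightarrow> real"
  assumes "continuous_on {a..b} f"
  obtains p :: "nat \<Rightarrow> real poly" where "uniform_limit {a..b} (\<lambda>n. poly (p n)) f sequentially"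
proof -
  have "\<exists>p::real poly. \<forall>x\<in>{a..b}. dist (poly p x) (f x) < e" if "e > 0" for e
  proof -
    obtain g where g: "real_polynomial_function g" "\<And>x. x \<in> {a..b} \<Longrightarrow> \<bar>f x - g x\<bar> < e"
      using Stone_Weierstrass_real_polynomial_function[OF _ assms \<open>e > 0\<close>] by auto
    then obtain c n where "g = (\<lambda>x. \<Sum>i\<le>n. c i * x ^ i)"
      by (auto simp: real_polynomial_function_iff_sum)
    then have "g = poly (\<Sum>i\<le>n. monom (c i) i)"
      by (simp add: fun_eq_iff poly_sum poly_monom)
    with g(2) show ?thesis
      by (metis dist_real_def dist_commute)
  qed
  then have "\<forall>n. \<exists>p::real poly. \<forall>x\<in>{a..b}. dist (poly p x) (f x) < inverse (real (Suc n))"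
    by simp
  then obtain p :: "nat \<Rightarrow> real poly"
    where p: "\<And>n x. x \<in> {a..b} \<Longrightarrow> dist (poly (p n) x) (f x) < inverse (real (Suc n))"
    by metis
  have "uniform_limit {a..b} (\<lambda>n. poly (p n)) f sequentially"
  proof (rule uniform_limitI)
    fix e :: real
    assume "e > 0"
    then have "\<forall>\<^sub>F n in sequentially. inverse (real (Suc n)) < e"
      using order_tendstoD(2)[OF LIMSEQ_inverse_real_of_nat] by blast
    then show "\<forall>\<^sub>F n in sequentially. \<forall>x\<in>{a..b}. dist (poly (p n) x) (f x) < e"
      by eventually_elim (meson p less_trans)
  qed
  then show ?thesis
    by (rule that)
qed

lemma spectrum_polynomial_approx:
  assumes "T \<in> pos_inv_ops" and "continuous_on {0<..} f"
  obtains p :: "nat \<Rightarrow> real poly"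
  where "uniform_limit (real_spectrum T) (\<lambda>n. poly (p n)) f sequentially"
proof -
  obtain a b where ab: "0 < a" "real_spectrum T \<subseteq> {a..b}"
    using real_spectrum_pos_inv[OF assms(1)] .
  have "continuous_on {a..b} f"
    using assms(2) by (rule continuous_on_subset) (use ab in auto)
  then obtain p :: "nat \<Rightarrow> real poly" where "uniform_limit {a..b} (\<lambda>n. poly (p n)) f sequentially"
    by (rule polynomial_uniform_approx)
  then show ?thesis
    using that uniform_limit_on_subset ab(2) by blast
qed

text \<open>The approximating sequence \<open>p0\<close> secures uniqueness: with no such sequence
  the condition inside \<open>THE\<close> would hold vacuously for every operator.\<close>

lemma cfc_eqI:
  assumes "\<And>p. uniform_limit (real_spectrum T) (\<lambda>n. poly (p n)) f sequentially \<Longrightarrow>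
      (\<lambda>n. op_poly (p n) T) \<longlonglongrightarrow> S"
    and "uniform_limit (real_spectrum T) (\<lambda>n. poly (p0 n)) f sequentially"
  shows "cfc f T = S"
  unfolding cfc_def
proof (rule the_equality)
  fix R
  assume "\<forall>p. uniform_limit (real_spectrum T) (\<lambda>n. poly (p n)) f sequentially \<longrightarrow>
      (\<lambda>n. op_poly (p n) T) \<longlonglongrightarrow> R"
  then show "R = S"
    using assms LIMSEQ_unique by blast
qed (use assms(1) in blast)

text \<open>Applied to the difference of two approximating sequences, this makes the limit
  independent of the choice of sequence.\<close>

lemma op_poly_uniform_null:
  assumes T: "T \<in> pos_inv_ops"
    and lim: "uniform_limit (real_spectrum T) (\<lambda>n. poly (p n)) (\<lambda>_. 0) sequentially"
  shows "(\<lambda>n. op_poly (p n) T) \<longlonglongrightarrow> 0"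
proof (rule tendstoI)
  fix e :: real
  assume "e > 0"
  then have "\<forall>\<^sub>F n in sequentially. \<forall>t\<in>real_spectrum T. dist (poly (p n) t) 0 < e / 2"
    by (intro uniform_limitD[OF lim]) simp
  then show "\<forall>\<^sub>F n in sequentially. dist (op_poly (p n) T) 0 < e"
  proof eventually_elim
    case (elim n)
    then have "norm (op_poly (p n) T) \<le> e / 2"
      using \<open>e > 0\<close> by (intro norm_op_poly_le pos_inv_opsD[OF T]) (auto intro: less_imp_le)
    with \<open>e > 0\<close> show ?case
      by simp
  qed
qed

text \<open>The norm bound by the supremum on the spectrum makes \<open>op_poly (p n) T\<close> a
  Cauchy sequence, and the space of operators is complete.\<close>

lemma cfc_tendsto:
  fixes T :: "'a::complex_hilbert_space \<Rightarrow>\<^sub>L 'a"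
  assumes T: "T \<in> pos_inv_ops" and f: "continuous_on {0<..} f"
    and p: "uniform_limit (real_spectrum T) (\<lambda>n. poly (p n)) f sequentially"
  shows "(\<lambda>n. op_poly (p n) T) \<longlonglongrightarrow> cfc f T"
proof -
  have "Cauchy (\<lambda>n. op_poly (p n) T)"
  proof (rule metric_CauchyI)
    fix e :: real
    assume "e > 0"
    then have "\<forall>\<^sub>F n in sequentially. \<forall>t\<in>real_spectrum T. dist (poly (p n) t) (f t) < e / 4"
      by (intro uniform_limitD[OF p]) simp
    then obtain N where N: "\<And>n t. n \<ge> N \<Longrightarrow> t \<in> real_spectrum T \<Longrightarrow> dist (poly (p n) t) (f t) < e / 4"
      unfolding eventually_sequentially by blast
    have "dist (op_poly (p m) T) (op_poly (p n) T) < e" if "m \<ge> N" "n \<ge> N" for m n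
    proof -
      have "\<bar>poly (p m - p n) t\<bar> \<le> e / 2" if "t \<in> real_spectrum T" for t
        using N[OF \<open>m \<ge> N\<close> that] N[OF \<open>n \<ge> N\<close> that]
        unfolding dist_real_def poly_diff by linarith
      then have "norm (op_poly (p m - p n) T) \<le> e / 2"
        using \<open>e > 0\<close> by (intro norm_op_poly_le pos_inv_opsD[OF T]) auto
      with \<open>e > 0\<close> show ?thesis
        by (simp add: dist_norm op_poly_diff)
    qed
    then show "\<exists>N. \<forall>m\<ge>N. \<forall>n\<ge>N. dist (op_poly (p m) T) (op_poly (p n) T) < e"
      by blast
  qed
  then obtain S where S: "(\<lambda>n. op_poly (p n) T) \<longlonglongrightarrow> S"
    by (auto simp: Cauchy_convergent_iff convergent_def)
  have "cfc f T = S"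
  proof (rule cfc_eqI[OF _ p])
    fix q
    assume "uniform_limit (real_spectrum T) (\<lambda>n. poly (q n)) f sequentially"
    from uniform_limit_minus[OF this p]
    have "uniform_limit (real_spectrum T) (\<lambda>n. poly (q n - p n)) (\<lambda>_. 0) sequentially"
      by (simp flip: poly_diff)
    from tendsto_add[OF op_poly_uniform_null[OF T this] S]
    show "(\<lambda>n. op_poly (q n) T) \<longlonglongrightarrow> S"
      by (simp add: op_poly_diff)
  qed
  with S show ?thesis
    by simp
qed

text \<open>The spectrum lies in the open half-line, so values at nonpositive arguments, often mere
  conventions of \<open>ln\<close> or \<open>powr\<close>, are irrelevant.\<close>

lemma cfc_cong:
  assumes T: "T \<in> pos_inv_ops" and "\<And>t. t > 0 \<Longrightarrow> f t = g t"
  shows "cfc f T = cfc g T"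
proof -
  have "f t = g t" if "t \<in> real_spectrum T" for t
    using real_spectrum_pos_inv[OF T] that assms(2) by (metis atLeastAtMost_iff less_le_trans subsetD)
  then have "uniform_limit (real_spectrum T) (\<lambda>n. poly (p n)) f sequentially \<longleftrightarrow>
      uniform_limit (real_spectrum T) (\<lambda>n. poly (p n)) g sequentially" for p :: "nat \<Rightarrow> real poly"
    by (intro uniform_limit_cong') auto
  then show ?thesis
    by (simp add: cfc_def)
qed

lemma cfc_poly:
  assumes "T \<in> pos_inv_ops"
  shows "cfc (poly p) T = op_poly p T"
proof -
  have "(\<lambda>n. op_poly p T) \<longlonglongrightarrow> cfc (poly p) T"
    by (rule cfc_tendsto[OF assms]) (auto intro: continuous_intros uniform_limit_const)
  then show ?thesis
    by (simp add: LIMSEQ_const_iff)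
qed

lemma cfc_const: "T \<in> pos_inv_ops \<Longrightarrow> cfc (\<lambda>_. c) T = c *\<^sub>R id_blinfun"
  using cfc_poly[of T "[:c:]"] cfc_cong[of T "poly [:c:]" "\<lambda>_. c"] by simp

lemma cfc_ident: "T \<in> pos_inv_ops \<Longrightarrow> cfc (\<lambda>t. t) T = T"
  using cfc_poly[of T "[:0, 1:]"] cfc_cong[of T "poly [:0, 1:]" "\<lambda>t. t"] by simp

section \<open>Algebraic and order properties of the functional calculus\<close>

lemma cfc_add:
  assumes T: "T \<in> pos_inv_ops" and f: "continuous_on {0<..} f" and g: "continuous_on {0<..} g"
  shows "cfc (\<lambda>t. f t + g t) T = cfc f T + cfc g T"
proof -
  obtain p q :: "nat \<Rightarrow> real poly"
    where p: "uniform_limit (real_spectrum T) (\<lambda>n. poly (p n)) f sequentially"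
      and q: "uniform_limit (real_spectrum T) (\<lambda>n. poly (q n)) g sequentially"
    using spectrum_polynomial_approx[OF T] f g by metis
  have "uniform_limit (real_spectrum T) (\<lambda>n. poly (p n + q n)) (\<lambda>t. f t + g t) sequentially"
    using uniform_limit_add[OF p q] by (simp flip: poly_add)
  from cfc_tendsto[OF T continuous_on_add[OF f g] this] show ?thesis
    using tendsto_add[OF cfc_tendsto[OF T f p] cfc_tendsto[OF T g q]] LIMSEQ_unique
    by (auto simp: op_poly_add)
qed

lemma cfc_mult:
  assumes T: "T \<in> pos_inv_ops" and f: "continuous_on {0<..} f" and g: "continuous_on {0<..} g"
  shows "cfc (\<lambda>t. f t * g t) T = cfc f T o\<^sub>L cfc g T"
proof -
  obtain a b where ab: "0 < a" "real_spectrum T \<subseteq> {a..b}"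
    using real_spectrum_pos_inv[OF T] .
  \<comment> \<open>Uniform convergence of a product requires bounded limit functions; compactness
    of \<open>{a..b}\<close> provides this.\<close>
  have bounded: "bounded (h ` real_spectrum T)" if "continuous_on {0<..} h" for h :: "real \<Rightarrow> real"
  proof -
    have "continuous_on {a..b} h"
      using that by (rule continuous_on_subset) (use ab in auto)
    then show ?thesis
      using ab(2) by (meson bounded_subset compact_Icc compact_continuous_image compact_imp_bounded image_mono)
  qed
  obtain p q :: "nat \<Rightarrow> real poly"
    where p: "uniform_limit (real_spectrum T) (\<lambda>n. poly (p n)) f sequentially"
      and q: "uniform_limit (real_spectrum T) (\<lambda>n. poly (q n)) g sequentially"
    using spectrum_polynomial_approx[OF T] f g by metis
  have "uniform_limit (real_spectrum T) (\<lambda>n. poly (p n * q n)) (\<lambda>t. f t * g t) sequentially"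
    using uniform_lim_mult[OF p q bounded[OF f] bounded[OF g]] by (simp flip: poly_mult)
  from cfc_tendsto[OF T continuous_on_mult[OF f g] this] show ?thesis
    using bounded_bilinear.tendsto[OF bounded_bilinear_blinfun_compose
        cfc_tendsto[OF T f p] cfc_tendsto[OF T g q]] LIMSEQ_unique
    by (auto simp: op_poly_mult)
qed

lemma cfc_scaleR:
  assumes "T \<in> pos_inv_ops" and "continuous_on {0<..} f"
  shows "cfc (\<lambda>t. c * f t) T = c *\<^sub>R cfc f T"
  using cfc_mult[OF assms(1) continuous_on_const assms(2), of c]
  by (simp add: cfc_const[OF assms(1)] op_simps)

text \<open>Approximating polynomials eventually exceed \<open>C\<close> by at most \<open>e\<close>
  on the spectrum, so the polynomial bound survives in the limit.\<close>

lemma norm_cfc_le: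
  assumes T: "T \<in> pos_inv_ops" and f: "continuous_on {0<..} f"
    and C: "\<And>t. t \<in> real_spectrum T \<Longrightarrow> \<bar>f t\<bar> \<le> C" "0 \<le> C"
  shows "norm (cfc f T) \<le> C"
proof (rule field_le_epsilon)
  fix e :: real
  assume "e > 0"
  obtain p :: "nat \<Rightarrow> real poly"
    where p: "uniform_limit (real_spectrum T) (\<lambda>n. poly (p n)) f sequentially"
    using spectrum_polynomial_approx[OF T f] .
  have "\<forall>\<^sub>F n in sequentially. norm (op_poly (p n) T) \<le> C + e"
    using uniform_limitD[OF p \<open>e > 0\<close>]
  proof eventually_elim
    case (elim n)
    show ?case
    proof (intro norm_op_poly_le pos_inv_opsD[OF T])
      fix t
      assume "t \<in> real_spectrum T"
      with elim C(1)[of t] show "\<bar>poly (p n) t\<bar> \<le> C + e"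
        by (force simp: dist_real_def)
    qed (use C \<open>e > 0\<close> in auto)
  qed
  then show "norm (cfc f T) \<le> C + e"
    by (rule tendsto_upperbound[OF tendsto_norm[OF cfc_tendsto[OF T f p]]]) simp
qed

lemma cfc_bounded_ops:
  assumes T: "T \<in> pos_inv_ops" and f: "continuous_on {0<..} f"
  shows "cfc f T \<in> bounded_ops"
  using spectrum_polynomial_approx[OF T f] tendsto_bounded_ops[OF cfc_tendsto[OF T f]]
    op_poly_bounded_ops[OF pos_inv_opsD(1)[OF T]] by metis

lemma cfc_self_adjoint:
  assumes T: "T \<in> pos_inv_ops" and f: "continuous_on {0<..} f"
  shows "self_adjoint (cfc f T)"
  using spectrum_polynomial_approx[OF T f] tendsto_self_adjoint[OF cfc_tendsto[OF T f]]
    op_poly_self_adjoint[OF pos_inv_opsD(2)[OF T]] by metis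

lemma cfc_inverse:
  assumes T: "T \<in> pos_inv_ops" and f: "continuous_on {0<..} f" and g: "continuous_on {0<..} g"
    and "\<And>t. t > 0 \<Longrightarrow> f t * g t = 1"
  shows "cfc f T o\<^sub>L cfc g T = id_blinfun"
proof -
  have "cfc f T o\<^sub>L cfc g T = cfc (\<lambda>_. 1) T"
    unfolding cfc_mult[OF T f g, symmetric] by (rule cfc_cong[OF T assms(4)])
  then show ?thesis
    by (simp add: cfc_const[OF T])
qed

text \<open>\<open>cfc f T\<close> is the square of the self-adjoint operator obtained from
  \<open>sqrt (f t)\<close>, and its inverse comes from \<open>inverse (f t)\<close>.\<close>

lemma cfc_pos_inv:
  assumes T: "T \<in> pos_inv_ops" and f: "continuous_on {0<..} f" and pos: "\<And>t. t > 0 \<Longrightarrow> f t > 0"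
  shows "cfc f T \<in> pos_inv_ops"
proof -
  have s: "continuous_on {0<..} (\<lambda>t. sqrt (f t))"
    by (intro continuous_intros f)
  have i: "continuous_on {0<..} (\<lambda>t. inverse (f t))"
    using pos by (intro continuous_intros f) (metis greaterThan_iff less_irrefl)
  have "cfc f T = cfc (\<lambda>t. sqrt (f t) * sqrt (f t)) T"
    by (rule cfc_cong[OF T]) (simp add: pos less_imp_le)
  also have "\<dots> = cfc (\<lambda>t. sqrt (f t)) T o\<^sub>L cfc (\<lambda>t. sqrt (f t)) T"
    by (rule cfc_mult[OF T s s])
  finally have "0 \<le> Re (cinner (cfc f T x) x)" for x
    using self_adjointD[OF cfc_self_adjoint[OF T s], of "cfc (\<lambda>t. sqrt (f t)) T x" x]
    by (simp add: cinner_self)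
  moreover have "op_invertible (cfc f T)"
    unfolding op_invertible_def using pos
    by (intro bexI[OF _ cfc_bounded_ops[OF T i]] conjI cfc_inverse[OF T] f i) (auto simp: less_imp_neq[symmetric])
  ultimately show ?thesis
    by (simp add: pos_inv_ops_def cfc_bounded_ops[OF T f] cfc_self_adjoint[OF T f])
qed

text \<open>For polynomial \<open>f\<close> the rule follows from the algebraic ones by induction;
  in general both sides are limits along one polynomial sequence approximating
  \<open>f\<close>.\<close>

lemma cfc_compose:
  fixes T :: "'a::complex_hilbert_space \<Rightarrow>\<^sub>L 'a"
  assumes T: "T \<in> pos_inv_ops" and f: "continuous_on {0<..} f"
    and g: "continuous_on {0<..} g" and pos: "\<And>t. t > 0 \<Longrightarrow> g t > 0"
  shows "cfc f (cfc g T) = cfc (\<lambda>t. f (g t)) T"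
proof -
  note gT = cfc_pos_inv[OF T g pos]
  have fg: "continuous_on {0<..} (\<lambda>t. f (g t))"
    using pos by (intro continuous_on_compose2[OF f g]) auto
  obtain a b where ab: "0 < a" "real_spectrum T \<subseteq> {a..b}"
    using real_spectrum_pos_inv[OF T] .
  obtain a' b' where ab': "0 < a'" "real_spectrum (cfc g T) \<subseteq> {a'..b'}"
    using real_spectrum_pos_inv[OF gT] .
  have g_ab: "continuous_on {a..b} g"
    using g by (rule continuous_on_subset) (use ab in auto)
  obtain c d where cd: "c > 0" "\<And>t. t \<in> {a..b} \<Longrightarrow> c \<le> g t \<and> g t \<le> d"
  \<comment> \<open>The spectral bounds need not satisfy \<open>a \<le> b\<close>; over an empty
    interval any positive \<open>c\<close> works.\<close>
  proof (cases "{a..b} = {}")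
    case True
    with that[of 1] show ?thesis
      by auto
  next
    case False
    obtain s u where "s \<in> {a..b}" "\<forall>t\<in>{a..b}. g s \<le> g t" "\<forall>t\<in>{a..b}. g t \<le> g u"
      using continuous_attains_inf[OF compact_Icc False g_ab]
        continuous_attains_sup[OF compact_Icc False g_ab] by blast
    with that[of "g s" "g u"] pos[of s] ab(1) show ?thesis
      by auto
  qed
  \<comment> \<open>One interval covers both the spectrum of \<open>cfc g T\<close> and the values
    of \<open>g\<close> on \<open>{a..b}\<close>, which avoids relating these two sets.\<close>
  have "continuous_on {min a' c..max b' d} f"
    using f by (rule continuous_on_subset) (use ab' cd in auto)
  then obtain p :: "nat \<Rightarrow> real poly"
    where p: "uniform_limit {min a' c..max b' d} (\<lambda>n. poly (p n)) f sequentially"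
    by (rule polynomial_uniform_approx)
  have lim1: "(\<lambda>n. op_poly (p n) (cfc g T)) \<longlonglongrightarrow> cfc f (cfc g T)"
    by (intro cfc_tendsto[OF gT f uniform_limit_on_subset[OF p]] subset_trans[OF ab'(2)]) auto
  have poly_g: "continuous_on {0<..} (\<lambda>t. poly q (g t))" for q
    by (intro continuous_intros g)
  have poly_compose: "op_poly q (cfc g T) = cfc (\<lambda>t. poly q (g t)) T" for q
  proof (induction q)
    case 0
    then show ?case
      by (simp add: cfc_const[OF T])
  next
    case (pCons r q)
    then show ?case
      using T g poly_g
      by (simp add: op_poly_pCons cfc_add cfc_mult cfc_const continuous_on_mult)
  qed
  have lim2: "(\<lambda>n. cfc (\<lambda>t. poly (p n) (g t)) T) \<longlonglongrightarrow> cfc (\<lambda>t. f (g t)) T"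
  proof (rule tendstoI)
    fix e :: real
    assume "e > 0"
    then have "\<forall>\<^sub>F n in sequentially. \<forall>t\<in>{min a' c..max b' d}. dist (poly (p n) t) (f t) < e / 2"
      by (intro uniform_limitD[OF p]) simp
    then show "\<forall>\<^sub>F n in sequentially. dist (cfc (\<lambda>t. poly (p n) (g t)) T) (cfc (\<lambda>t. f (g t)) T) < e"
    proof eventually_elim
      case (elim n)
      have "norm (cfc (\<lambda>t. poly (p n) (g t) + (- 1) * f (g t)) T) \<le> e / 2"
      proof (intro norm_cfc_le T continuous_intros poly_g fg)
        fix t
        assume "t \<in> real_spectrum T"
        then have "t \<in> {a..b}"
          using ab(2) by blast
        from cd(2)[OF this] have "g t \<in> {min a' c..max b' d}"
          by (simp add: min_le_iff_disj le_max_iff_disj)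
        with elim have "dist (poly (p n) (g t)) (f (g t)) < e / 2"
          by blast
        then show "\<bar>poly (p n) (g t) + (- 1) * f (g t)\<bar> \<le> e / 2"
          by (simp add: dist_real_def)
      qed (use g \<open>e > 0\<close> in simp_all)
      also have "cfc (\<lambda>t. poly (p n) (g t) + (- 1) * f (g t)) T
          = cfc (\<lambda>t. poly (p n) (g t)) T - cfc (\<lambda>t. f (g t)) T"
        using cfc_add[OF T poly_g[of "p n"] continuous_on_mult[OF continuous_on_const[of _ "- 1"] fg]]
          cfc_scaleR[OF T fg, of "- 1"] by simp
      finally show ?case
        using \<open>e > 0\<close> by (simp add: dist_norm)
    qed
  qed
  from LIMSEQ_unique[OF lim1] lim2 show ?thesis
    by (simp add: poly_compose)
qed

text \<open>Similarity preserves the real spectrum and passes through polynomials. Convergence is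
  carried over from \<open>T\<close>, since \<open>W o\<^sub>L T o\<^sub>L V\<close> is not assumed
  self-adjoint.\<close>

lemma cfc_similar:
  fixes T :: "'a::complex_hilbert_space \<Rightarrow>\<^sub>L 'a"
  assumes T: "T \<in> pos_inv_ops" and f: "continuous_on {0<..} f"
    and W: "W \<in> bounded_ops" "V \<in> bounded_ops" "W o\<^sub>L V = id_blinfun" "V o\<^sub>L W = id_blinfun"
  shows "cfc f (W o\<^sub>L T o\<^sub>L V) = W o\<^sub>L cfc f T o\<^sub>L V"
proof -
  have WV: "W (V x) = x" "V (W x) = x" for x
    using W by (simp_all add: blinfun_eq_iff)
  have inv: "op_invertible W" "op_invertible V"
    using W by (auto simp: op_invertible_def)
  have shift: "W o\<^sub>L (T - c *\<^sub>R id_blinfun) o\<^sub>L V = (W o\<^sub>L T o\<^sub>L V) - c *\<^sub>R id_blinfun"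
    "V o\<^sub>L ((W o\<^sub>L T o\<^sub>L V) - c *\<^sub>R id_blinfun) o\<^sub>L W = T - c *\<^sub>R id_blinfun" for c
    by (simp_all add: op_simps WV)
  have "op_invertible ((W o\<^sub>L T o\<^sub>L V) - c *\<^sub>R id_blinfun) \<longleftrightarrow> op_invertible (T - c *\<^sub>R id_blinfun)" for c
    using op_invertible_compose inv shift by metis
  then have spec: "real_spectrum (W o\<^sub>L T o\<^sub>L V) = real_spectrum T"
    by (simp add: Re_op_spectrum_iff)
  have poly: "op_poly p (W o\<^sub>L T o\<^sub>L V) = W o\<^sub>L op_poly p T o\<^sub>L V" for p
    by (induction p) (simp_all add: op_poly_pCons op_simps WV)
  obtain p where "uniform_limit (real_spectrum T) (\<lambda>n. poly (p n)) f sequentially"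
    using spectrum_polynomial_approx[OF T f] .
  then show ?thesis
    by (intro cfc_eqI[of "W o\<^sub>L T o\<^sub>L V" f _ p])
      (auto simp: poly spec intro!: bounded_bilinear.tendsto[OF bounded_bilinear_blinfun_compose]
        tendsto_const cfc_tendsto[OF T f])
qed

section \<open>Operator means\<close>

lemma congruence_pos_inv:
  assumes K: "K \<in> pos_inv_ops" and X: "X \<in> pos_inv_ops"
  shows "K o\<^sub>L X o\<^sub>L K \<in> pos_inv_ops"
proof -
  have "0 \<le> Re (cinner ((K o\<^sub>L X o\<^sub>L K) x) x)" for x
    using pos_inv_opsD(3)[OF X, of "K x"] self_adjointD[OF pos_inv_opsD(2)[OF K], of "X (K x)" x]
    by simp
  then show ?thesis
    using pos_inv_opsD[OF K] pos_inv_opsD[OF X]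
    by (simp add: pos_inv_ops_def compose_bounded_ops op_invertible_compose self_adjoint_def)
qed

text \<open>Exponents add under \<open>cfc_mult\<close>, so the power \<open>1/2\<close> is a square
  root of \<open>A\<close> and the power \<open>-1/2\<close> inverts it. The pointwise forms serve
  as rewrite rules.\<close>

lemma op_powr_half:
  assumes "A \<in> pos_inv_ops"
  shows "op_powr A (1/2) \<in> pos_inv_ops" "op_powr A (-1/2) \<in> pos_inv_ops"
    and "op_powr A (1/2) (op_powr A (1/2) x) = A x"
    and "op_powr A (1/2) (op_powr A (-1/2) x) = x"
    and "op_powr A (-1/2) (op_powr A (1/2) x) = x"
proof -
  have c: "continuous_on {0<..} (\<lambda>t. t powr r)" for r :: real
    by (intro continuous_intros) auto
  show "op_powr A (1/2) \<in> pos_inv_ops" "op_powr A (-1/2) \<in> pos_inv_ops"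
    unfolding op_powr_def by (intro cfc_pos_inv assms c; simp)+
  have "op_powr A (1/2) o\<^sub>L op_powr A (1/2) = cfc (\<lambda>t. t powr (1/2) * t powr (1/2)) A"
    unfolding op_powr_def by (rule cfc_mult[OF assms c c, symmetric])
  also have "\<dots> = A"
    unfolding powr_add[symmetric] using cfc_cong[OF assms, of "\<lambda>t. t powr (1/2 + 1/2)" "\<lambda>t. t"]
    by (simp add: cfc_ident[OF assms])
  finally show "op_powr A (1/2) (op_powr A (1/2) x) = A x"
    by (simp add: blinfun_eq_iff)
  have "op_powr A (1/2) o\<^sub>L op_powr A (-1/2) = id_blinfun" "op_powr A (-1/2) o\<^sub>L op_powr A (1/2) = id_blinfun"
    unfolding op_powr_def by (rule cfc_inverse[OF assms c c]; simp flip: powr_add)+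
  then show "op_powr A (1/2) (op_powr A (-1/2) x) = x" "op_powr A (-1/2) (op_powr A (1/2) x) = x"
    by (simp_all add: blinfun_eq_iff)
qed

text \<open>
  With \<open>P = K h(Y) K\<close> and \<open>Q = K k(Y) K\<close>, the operator \<open>P\<^sup>-\<^sup>1\<^sup>/\<^sup>2 Q P\<^sup>-\<^sup>1\<^sup>/\<^sup>2\<close> is similar to
  \<open>(k/h)(Y)\<close> through \<open>W = P\<^sup>1\<^sup>/\<^sup>2 K\<^sup>-\<^sup>1\<close>.
\<close>

lemma op_mean_cfc:
  fixes Y K :: "'a::complex_hilbert_space \<Rightarrow>\<^sub>L 'a"
  assumes Y: "Y \<in> pos_inv_ops" and K: "K \<in> pos_inv_ops"
    and h: "continuous_on {0<..} h" "\<And>t. t > 0 \<Longrightarrow> h t > 0"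
    and k: "continuous_on {0<..} k" "\<And>t. t > 0 \<Longrightarrow> k t > 0"
    and F: "continuous_on {0<..} F"
  shows "op_mean F (K o\<^sub>L cfc h Y o\<^sub>L K) (K o\<^sub>L cfc k Y o\<^sub>L K) =
    K o\<^sub>L cfc (\<lambda>t. h t * F (k t / h t)) Y o\<^sub>L K"
proof -
  define P where "P = K o\<^sub>L cfc h Y o\<^sub>L K"
  have P: "P \<in> pos_inv_ops"
    unfolding P_def by (intro congruence_pos_inv cfc_pos_inv K Y h)
  define S R where "S = op_powr P (1/2)" and "R = op_powr P (-1/2)"
  note SR = op_powr_half[OF P, folded S_def R_def]
  obtain L where L: "L \<in> bounded_ops" "L o\<^sub>L K = id_blinfun" "K o\<^sub>L L = id_blinfun"
    using pos_inv_opsD(4)[OF K] by (auto simp: op_invertible_def)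
  have LK: "L (K x) = x" "K (L x) = x" for x
    using L by (simp_all add: blinfun_eq_iff)
  have h_ne: "h t \<noteq> 0" if "t > 0" for t
    using h(2)[OF that] by simp
  have kh: "continuous_on {0<..} (\<lambda>t. k t / h t)" "\<And>t. t > 0 \<Longrightarrow> k t / h t > 0"
    using h_ne h(2) k(2) by (auto intro!: continuous_intros h(1) k(1))
  have Fkh: "continuous_on {0<..} (\<lambda>t. F (k t / h t))"
    using kh(2) by (intro continuous_on_compose2[OF F kh(1)]) auto
  define D where "D = cfc (\<lambda>t. k t / h t) Y"
  have D: "D \<in> pos_inv_ops"
    unfolding D_def by (rule cfc_pos_inv[OF Y kh])
  have "cfc k Y = cfc (\<lambda>t. h t * (k t / h t)) Y"
    by (rule cfc_cong[OF Y]) (simp add: h_ne)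
  also have "\<dots> = cfc h Y o\<^sub>L D"
    unfolding D_def by (rule cfc_mult[OF Y h(1) kh(1)])
  finally have k_eq: "cfc k Y = cfc h Y o\<^sub>L D" .
  \<comment> \<open>Both sides are \<open>P\<close> applied to \<open>L x\<close>, where
    \<open>L\<close> inverts \<open>K\<close> and \<open>S\<close> is the square root of
    \<open>P\<close>.\<close>
  have SS: "K (cfc h Y x) = S (S (L x))" for x
    by (simp add: SR P_def LK)
  \<comment> \<open>Since \<open>cfc k Y\<close> is \<open>cfc h Y\<close> times \<open>D\<close>,
    the left factor \<open>R\<close> cancels one \<open>S\<close> from \<open>SS\<close>; the
    operators \<open>S o\<^sub>L L\<close> and \<open>K o\<^sub>L R\<close> are mutually
    inverse.\<close>
  have similar: "R o\<^sub>L (K o\<^sub>L cfc k Y o\<^sub>L K) o\<^sub>L R = (S o\<^sub>L L) o\<^sub>L D o\<^sub>L (K o\<^sub>L R)"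
    by (rule blinfun_eqI) (simp add: k_eq SS SR(5))
  have "cfc F (R o\<^sub>L (K o\<^sub>L cfc k Y o\<^sub>L K) o\<^sub>L R) = (S o\<^sub>L L) o\<^sub>L cfc F D o\<^sub>L (K o\<^sub>L R)"
    unfolding similar
    by (rule cfc_similar[OF D F])
      (simp_all add: blinfun_eq_iff compose_bounded_ops pos_inv_opsD(1) SR(1,2,4,5) K L(1) LK)
  also have "cfc F D = cfc (\<lambda>t. F (k t / h t)) Y"
    unfolding D_def by (rule cfc_compose[OF Y F kh])
  finally have *: "cfc F (R o\<^sub>L (K o\<^sub>L cfc k Y o\<^sub>L K) o\<^sub>L R)
      = (S o\<^sub>L L) o\<^sub>L cfc (\<lambda>t. F (k t / h t)) Y o\<^sub>L (K o\<^sub>L R)" .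
  show ?thesis
    unfolding op_mean_def P_def[symmetric] S_def[symmetric] R_def[symmetric] *
      cfc_mult[OF Y h(1) Fkh]
    by (rule blinfun_eqI) (simp add: SS SR(5))
qed

section \<open>Scalar means\<close>

text \<open>The slope of the chord of \<open>ln\<close> between 1 and \<open>x\<close>, completed by
  the derivative at 1. It absorbs the removable singularity of both unweighted means.\<close>

definition ln_slope :: "real \<Rightarrow> real" where
  "ln_slope x = (if x = 1 then 1 else ln x / (x - 1))"

lemma ln_slope_pos: "x > 0 \<Longrightarrow> ln_slope x > 0"
  by (cases x "1::real" rule: linorder_cases) (auto simp: ln_slope_def divide_neg_neg)

lemma continuous_on_ln_slope: "continuous_on {0<..} ln_slope"
proof (rule continuous_at_imp_continuous_on, intro ballI)
  fix x :: real
  assume "x \<in> {0<..}"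
  show "isCont ln_slope x"
  proof (cases "x = 1")
    case True
    have "((\<lambda>y. (ln y - ln 1) / (y - 1)) \<longlongrightarrow> 1) (at (1::real))"
      using DERIV_ln[of "1::real"] by (simp add: has_field_derivative_iff)
    then have "(ln_slope \<longlongrightarrow> 1) (at 1)"
      by (rule Lim_transform_eventually) (auto simp: ln_slope_def eventually_at_filter)
    then show ?thesis
      by (simp add: isCont_def True ln_slope_def)
  next
    case False
    have "\<forall>\<^sub>F y in nhds x. ln_slope y = ln y / (y - 1)"
      using t1_space_nhds[OF False] by eventually_elim (simp add: ln_slope_def)
    moreover have "isCont (\<lambda>y. ln y / (y - 1)) x"
      using False \<open>x \<in> {0<..}\<close> by (intro continuous_intros) auto
    ultimately show ?thesis
      by (simp add: isCont_cong)
  qed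
qed

text \<open>At weight \<open>1/2\<close> both coefficients equal 1 and the geometric terms cancel,
  leaving \<open>(x - 1) / ln x\<close>.\<close>

lemma log_mean_half_eq: "x > 0 \<Longrightarrow> log_mean (1/2) 1 x = 1 / ln_slope x"
  by (auto simp: log_mean_def ln_slope_def field_simps)

lemma identric_mean_half_eq:
  assumes "x > 0"
  shows "identric_mean (1/2) 1 x = exp (x * ln_slope x - 1)"
proof (cases "x = 1")
  case True
  then show ?thesis
    by (simp add: identric_mean_def ln_slope_def)
next
  case False
  \<comment> \<open>The exponent \<open>1 - 2 * v\<close> vanishes here, but \<open>0 powr 0\<close>
    is 0, so the base has to be nonzero.\<close>
  have "arith_mean (1/2) 1 x > 0"
    using assms by (simp add: arith_mean_def add_pos_pos)
  with False assms show ?thesis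
    by (simp add: identric_mean_def ln_slope_def powr_powr exp_diff) (simp add: powr_def)
qed

lemma continuous_on_log_mean_half: "continuous_on {0<..} (\<lambda>x. log_mean (1/2) 1 x)"
proof -
  have "continuous_on {0<..} (\<lambda>x. 1 / ln_slope x)"
    using ln_slope_pos by (intro continuous_intros continuous_on_ln_slope) (metis greaterThan_iff less_irrefl)
  then show ?thesis
    by (rule continuous_on_eq) (simp add: log_mean_half_eq)
qed

lemma continuous_on_identric_mean_half: "continuous_on {0<..} (\<lambda>x. identric_mean (1/2) 1 x)"
proof -
  have "continuous_on {0<..} (\<lambda>x. exp (x * ln_slope x - 1))"
    by (intro continuous_intros continuous_on_ln_slope)
  then show ?thesis
    by (rule continuous_on_eq) (simp add: identric_mean_half_eq)
qed

text \<open>The logarithmic identity for the scalars 1 and \<open>t\<close>, with each mean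
  \<open>L(p, c)\<close> written as \<open>p * L(1, c / p)\<close> for \<open>p = t powr v\<close>.
  The logarithms of \<open>1 / p\<close> and \<open>t / p\<close> are \<open>- v\<close> and
  \<open>1 - v\<close> times \<open>ln t\<close>.\<close>

lemma log_mean_decomposition:
  assumes t: "t > 0" and v: "0 \<le> v" "v \<le> 1"
  shows "log_mean v 1 t =
    (1 - v) * (t powr v * log_mean (1/2) 1 (1 / t powr v)) +
    v * (t powr v * log_mean (1/2) 1 (t / t powr v))"
proof (cases "v = 0 \<or> v = 1 \<or> t = 1")
  \<comment> \<open>Each inner mean either carries weight 0 or is taken at argument 1, where its
    value is 1 by convention.\<close>
  case True
  then show ?thesis
    using t by (auto simp: log_mean_def)
next
  case False
  define w p where "w = ln t" and "p = t powr v"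
  have "w \<noteq> 0" "p > 0"
    using False t by (auto simp: w_def p_def)
  have lnp: "ln (1 / p) = - (v * w)" "ln (t / p) = (1 - v) * w"
    using t by (simp_all add: p_def w_def ln_div ln_powr algebra_simps)
  have ne: "1 / p \<noteq> 1" "t / p \<noteq> 1"
    using lnp False \<open>w \<noteq> 0\<close> by (metis ln_one eq_iff_diff_eq_0 mult_eq_0_iff neg_equal_0_iff_equal)+
  have half1: "log_mean (1/2) 1 (1 / p) = (1 / p - 1) / (- (v * w))"
    using ne \<open>p > 0\<close> by (simp add: log_mean_half_eq ln_slope_def lnp)
  have half2: "log_mean (1/2) 1 (t / p) = (t / p - 1) / ((1 - v) * w)"
    using ne \<open>p > 0\<close> t by (simp add: log_mean_half_eq ln_slope_def lnp)
  have whole: "log_mean v 1 t = 1 / (- w) * ((1 - v) / v * (1 - p) + v / (1 - v) * (p - t))"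
    using False by (simp add: log_mean_def p_def w_def)
  show ?thesis
    unfolding p_def[symmetric] half1 half2 whole using False \<open>w \<noteq> 0\<close> \<open>p > 0\<close>
    by (simp add: divide_simps) (simp add: algebra_simps)
qed

text \<open>After taking logarithms, the claim is linear in \<open>ln g\<close> and
  \<open>ln t\<close>, so comparing coefficients suffices.\<close>

lemma identric_mean_decomposition:
  fixes t v :: real
  defines "g \<equiv> (1 - v) + v * t"
  assumes t: "t > 0" and v: "0 \<le> v" "v \<le> 1"
  shows "identric_mean v 1 t =
    g * identric_mean (1/2) 1 (1 / g) *
    (g * identric_mean (1/2) 1 (t / g) / (g * identric_mean (1/2) 1 (1 / g))) powr v"
proof (cases "v = 0 \<or> v = 1 \<or> t = 1")
  case True
  have "identric_mean 0 1 t = 1" "identric_mean 1 1 t = t" "identric_mean u 1 1 = 1" for u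
    by (simp_all add: identric_mean_def)
  \<comment> \<open>Needed as \<open>0 powr 0\<close> is 0 for \<open>v = 0\<close>, and as a
    nonzero denominator for \<open>v = 1\<close>.\<close>
  moreover have "identric_mean (1/2) 1 (1 / t) > 0" "identric_mean (1/2) 1 t > 0"
    using t by (simp_all add: identric_mean_half_eq)
  ultimately show ?thesis
    using True t by (auto simp: g_def less_imp_neq[symmetric])
next
  case False
  have "g > 0"
    using False t v by (auto simp: g_def intro!: add_pos_nonneg)
  \<comment> \<open>In terms of \<open>s\<close> the denominators factor:
    \<open>g - 1 = v * s\<close> and \<open>t - g = (1 - v) * s\<close>.\<close>
  define s where "s = t - 1"
  have "s \<noteq> 0" and ts: "t = 1 + s" and gs: "g = 1 + v * s"
    using False by (auto simp: s_def g_def algebra_simps)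
  have ne: "g \<noteq> 1" "t \<noteq> g"
    using False \<open>s \<noteq> 0\<close> by (auto simp: ts gs)
  \<comment> \<open>The logarithms of the unweighted identric means of \<open>g\<close> with 1 and
    with \<open>t\<close>.\<close>
  define e1 e2 where "e1 = ln g + ln g / (v * s) - 1"
    and "e2 = ln g + t * (ln t - ln g) / ((1 - v) * s) - 1"
  have "1 / g * ln_slope (1 / g) = ln g / (v * s)"
  proof -
    have "1 / g * ln_slope (1 / g) = ln g / (g - 1)"
      using ne \<open>g > 0\<close> by (simp add: ln_slope_def ln_div divide_simps) (simp add: algebra_simps)
    then show ?thesis
      by (simp add: gs)
  qed
  then have 1: "g * identric_mean (1/2) 1 (1 / g) = exp e1"
    using \<open>g > 0\<close> by (simp add: identric_mean_half_eq e1_def exp_add exp_diff)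
  have "t / g * ln_slope (t / g) = t * (ln t - ln g) / ((1 - v) * s)"
  proof -
    have "t / g * ln_slope (t / g) = t * (ln t - ln g) / (t - g)"
      using ne \<open>g > 0\<close> t by (simp add: ln_slope_def ln_div divide_simps)
    also have "t - g = (1 - v) * s"
      by (simp add: ts gs algebra_simps)
    finally show ?thesis .
  qed
  then have 2: "g * identric_mean (1/2) 1 (t / g) = exp e2"
    using \<open>g > 0\<close> t by (simp add: identric_mean_half_eq e2_def exp_add exp_diff)
  have "identric_mean v 1 t = exp ((1 - 2 * v) * g / (v * (1 - v) * s) * ln g +
      v * t / ((1 - v) * s) * ln t - 1)"
    using False t \<open>g > 0\<close>
    by (simp add: identric_mean_def arith_mean_def g_def[symmetric] s_def[symmetric] powr_powr exp_diff
        exp_add) (simp add: powr_def)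
  also have "(1 - 2 * v) * g / (v * (1 - v) * s) * ln g + v * t / ((1 - v) * s) * ln t - 1
      = e1 + v * (e2 - e1)"
  proof -
    define N M where "N = 1 / (v * s)" and "M = t / ((1 - v) * s)"
    have coeff: "(1 - 2 * v) * g / (v * (1 - v) * s) = (1 - v) * (1 + N) + v * (1 - M)"
      unfolding N_def M_def using False \<open>s \<noteq> 0\<close> by (simp add: ts gs divide_simps) algebra
    have vM: "v * t / ((1 - v) * s) = v * M"
      by (simp add: M_def)
    have e1: "e1 = ln g * (1 + N) - 1"
      by (simp add: e1_def N_def distrib_left)
    have e2: "e2 = ln g * (1 - M) + M * ln t - 1"
      by (simp add: e2_def M_def right_diff_distrib diff_divide_distrib)
    show ?thesis
      unfolding coeff vM e1 e2 by (simp add: algebra_simps)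
  qed
  also have "exp \<dots> = exp e1 * (exp e2 / exp e1) powr v"
    by (simp add: exp_add powr_def flip: exp_diff)
  finally show ?thesis
    by (simp add: 1 2)
qed

section \<open>Transfer of the scalar identities to operators\<close>

theorem theorem4p1:
  fixes A B :: "'a::complex_hilbert_space \<Rightarrow>\<^sub>L 'a" and v :: real
  assumes "A \<in> pos_inv_ops" and "B \<in> pos_inv_ops" and "0 \<le> v" and "v \<le> 1"
  shows "op_log_mean v A B =
           op_arith_mean v (op_log_mean (1/2) (op_geom_mean v A B) A)
                           (op_log_mean (1/2) (op_geom_mean v A B) B) \<and>
         op_identric_mean v A B =
           op_geom_mean v (op_identric_mean (1/2) (op_arith_mean v A B) A)
                          (op_identric_mean (1/2) (op_arith_mean v A B) B)"
proof -
  define K R Y where "K = op_powr A (1/2)" and "R = op_powr A (-1/2)" and "Y = R o\<^sub>L B o\<^sub>L R"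
  note KR = op_powr_half[OF \<open>A \<in> pos_inv_ops\<close>, folded K_def R_def]
  have Y: "Y \<in> pos_inv_ops"
    unfolding Y_def by (intro congruence_pos_inv KR assms)
  \<comment> \<open>Every operator in the claim is brought into the form \<open>J f\<close>; for
    means of \<open>A\<close> and \<open>B\<close> themselves this is the definition.\<close>
  define J where "J f = K o\<^sub>L cfc f Y o\<^sub>L K" for f
  have mean_AB: "op_mean F A B = J F" for F
    by (simp add: op_mean_def J_def K_def R_def Y_def)
  have A: "A = J (\<lambda>_. 1)" and B: "B = J (\<lambda>t. t)"
    unfolding J_def cfc_const[OF Y] cfc_ident[OF Y] by (simp_all add: blinfun_eq_iff Y_def KR)
  have J_mean: "op_mean F (J h) (J k) = J (\<lambda>t. h t * F (k t / h t))"
    if "continuous_on {0<..} h" "\<And>t. t > 0 \<Longrightarrow> h t > 0"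
      "continuous_on {0<..} k" "\<And>t. t > 0 \<Longrightarrow> k t > 0" "continuous_on {0<..} F" for F h k
    unfolding J_def by (rule op_mean_cfc[OF Y KR(1) that])
  have J_arith: "op_arith_mean v (J f) (J g) = J (\<lambda>t. (1 - v) * f t + v * g t)"
    if "continuous_on {0<..} f" "continuous_on {0<..} g" for f g
  proof -
    have "cfc (\<lambda>t. (1 - v) * f t + v * g t) Y = (1 - v) *\<^sub>R cfc f Y + v *\<^sub>R cfc g Y"
      using cfc_add[OF Y continuous_on_mult_left[OF that(1)] continuous_on_mult_left[OF that(2)]]
      by (simp add: cfc_scaleR[OF Y] that)
    then show ?thesis
      by (simp add: op_arith_mean_def J_def op_simps)
  qed
  have J_cong: "J f = J g" if "\<And>t. t > 0 \<Longrightarrow> f t = g t" for f g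
    unfolding J_def by (simp add: cfc_cong[OF Y that])
  have powr: "continuous_on {0<..} (\<lambda>t. t powr r)" for r :: real
    by (intro continuous_intros) auto
  \<comment> \<open>Functions produced by \<open>J_mean\<close> must be continuous to be fed into
    \<open>J_arith\<close> or into \<open>J_mean\<close> again.\<close>
  have ratio: "continuous_on {0<..} (\<lambda>t. h t * F (k t / h t))"
    if "continuous_on {0<..} h" "\<And>t. t > 0 \<Longrightarrow> h t > 0"
      "continuous_on {0<..} k" "\<And>t. t > 0 \<Longrightarrow> k t > 0" "continuous_on {0<..} F"
    for F h k :: "real \<Rightarrow> real"
  proof -
    have "continuous_on {0<..} (\<lambda>t. k t / h t)"
      using that by (intro continuous_intros) (auto simp: less_imp_neq[symmetric])
    then have "continuous_on {0<..} (\<lambda>t. F (k t / h t))"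
      by (rule continuous_on_compose2[OF that(5)]) (auto simp: that)
    then show ?thesis
      by (rule continuous_on_mult[OF that(1)])
  qed
  have "op_log_mean v A B = op_arith_mean v (op_log_mean (1/2) (op_geom_mean v A B) A)
      (op_log_mean (1/2) (op_geom_mean v A B) B)"
  proof -
    let ?F = "\<lambda>x. log_mean (1/2) 1 x"
    have geom: "op_geom_mean v A B = J (\<lambda>t. t powr v)"
      by (simp add: op_geom_mean_def mean_AB)
    have "op_log_mean (1/2) (op_geom_mean v A B) A = J (\<lambda>t. t powr v * ?F (1 / t powr v))"
      using J_mean[of "\<lambda>t. t powr v" "\<lambda>_. 1" ?F]
      by (simp add: op_log_mean_def geom A[symmetric] powr continuous_on_log_mean_half)
    moreover have "op_log_mean (1/2) (op_geom_mean v A B) B = J (\<lambda>t. t powr v * ?F (t / t powr v))"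
      using J_mean[of "\<lambda>t. t powr v" "\<lambda>t. t" ?F]
      by (simp add: op_log_mean_def geom B[symmetric] powr continuous_on_log_mean_half)
    moreover have "op_log_mean v A B = J (\<lambda>t. (1 - v) * (t powr v * ?F (1 / t powr v)) +
        v * (t powr v * ?F (t / t powr v)))"
      unfolding op_log_mean_def mean_AB
      using log_mean_decomposition assms(3,4) by (intro J_cong) blast
    ultimately show ?thesis
      using J_arith[OF ratio ratio, of "\<lambda>t. t powr v" "\<lambda>_. 1" ?F "\<lambda>t. t powr v" "\<lambda>t. t" ?F]
      by (simp add: powr continuous_on_log_mean_half)
  qed
  moreover have "op_identric_mean v A B = op_geom_mean v (op_identric_mean (1/2) (op_arith_mean v A B) A)
      (op_identric_mean (1/2) (op_arith_mean v A B) B)"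
  proof -
    let ?F = "\<lambda>x. identric_mean (1/2) 1 x"
    define g where "g = (\<lambda>t. (1 - v) + v * t)"
    have g: "continuous_on {0<..} g" "\<And>t. t > 0 \<Longrightarrow> g t > 0"
    proof -
      show "continuous_on {0<..} g"
        unfolding g_def by (intro continuous_intros)
      show "g t > 0" if "t > 0" for t
        using that assms(3,4) by (cases "v = 0") (auto simp: g_def intro!: add_nonneg_pos)
    qed
    have arith: "op_arith_mean v A B = J g"
      using J_arith[of "\<lambda>_. 1" "\<lambda>t. t"] by (simp add: A[symmetric] B[symmetric] g_def)
    define h where "h = (\<lambda>t. g t * ?F (1 / g t))"
    define k where "k = (\<lambda>t. g t * ?F (t / g t))"
    have h: "op_identric_mean (1/2) (op_arith_mean v A B) A = J h"
      using J_mean[OF g, of "\<lambda>_. 1" ?F]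
      by (simp add: op_identric_mean_def arith A[symmetric] h_def continuous_on_identric_mean_half)
    have k: "op_identric_mean (1/2) (op_arith_mean v A B) B = J k"
      using J_mean[OF g, of "\<lambda>t. t" ?F]
      by (simp add: op_identric_mean_def arith B[symmetric] k_def continuous_on_identric_mean_half)
    have cont: "continuous_on {0<..} h" "continuous_on {0<..} k"
      unfolding h_def k_def by (rule ratio; auto intro: g continuous_on_identric_mean_half)+
    have pos: "h t > 0" "k t > 0" if "t > 0" for t
      using g(2)[OF that] that by (simp_all add: h_def k_def identric_mean_half_eq)
    \<comment> \<open>The scalar identity already has the shape that \<open>J_mean\<close> gives for
      \<open>x powr v\<close> applied to \<open>h\<close> and \<open>k\<close>.\<close>
    have "op_identric_mean v A B = J (\<lambda>t. h t * (k t / h t) powr v)"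
      unfolding op_identric_mean_def mean_AB
      using identric_mean_decomposition assms(3,4) by (intro J_cong) (auto simp: h_def k_def g_def)
    also have "\<dots> = op_geom_mean v (J h) (J k)"
      unfolding op_geom_mean_def by (rule J_mean[symmetric]) (auto intro: cont pos powr)
    finally show ?thesis
      by (simp only: h k)
  qed
  ultimately show ?thesis
    by blast
qed

end
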